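(* Let $F$ be an h-conformal semi-invariant submersion, with dilation $\lambda$, from a hyperkähler manifold $(M,I,J,K,g_M)$ onto a Riemannian manifold $(N,g_N)$ such that $(I,J,K)$ is an h-conformal semi-invariant basis. For $R\in\{I,J,K\}$ let $(P_R)$ be the following condition: for all $V,W\in\Gamma(\mathcal{D}_1)$ and $X\in\Gamma((\ker F_* )^{\perp})$, $$(\nabla F_* )(V,RW)\in\Gamma(F_*\mu^R)\quad\text{and}\quad g_N((\nabla F_* )(V,RW),\,F_*C_RX)=\lambda^2g_M(W,\,\mathcal{T}_V\omega_RB_RX).$$ Then the following conditions are equivalent: (a) the distribution $\mathcal{D}_1$ defines a totally geodesic foliation on $M$; (b) $(P_I)$ holds; (c) $(P_J)$ holds; (d) $(P_K)$ holds.
   Context: All manifolds and maps are $C^\infty$; $\Gamma(\cdot)$ denotes smooth sections. A hyperkähler manifold $(M,I,J,K,g_M)$ is a Riemannian manifold with global sections $I,J,K$ of $\mathrm{End}(TM)$ satisfying $I^2=J^2=K^2=-\mathrm{id}$, $IJ=-JI=K$, $JK=-KJ=I$, $KI=-IK=J$, $g_M(RX,RY)=g_M(X,Y)$ and $\nabla R=0$ for $R\in\{I,J,K\}$, where $\nabla$ is the Levi-Civita connection of $g_M$. A horizontally conformal submersion $F:(M,g_M)\to(N,g_N)$ with dilation $\lambda:M\to(0,\infty)$ is a surjective submersion with $g_N(F_*X,F_*Y)=\lambda^2g_M(X,Y)$ for all $X,Y\in(\ker F_* )^{\perp}$. It is an h-conformal semi-invariant submersion with h-conformal semi-invariant basis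 $(I,J,K)$ if there is a distribution $\mathcal{D}_1\subset\ker F_*$ such that, for every $R\in\{I,J,K\}$, $\ker F_*=\mathcal{D}_1\oplus\mathcal{D}_2$, $R(\mathcal{D}_1)=\mathcal{D}_1$, $R(\mathcal{D}_2)\subset(\ker F_* )^{\perp}$, where $\mathcal{D}_2$ is the orthogonal complement of $\mathcal{D}_1$ in $\ker F_*$. Let $\mu^R$ be the orthogonal complement of $R\mathcal{D}_2$ in $(\ker F_* )^{\perp}$ (it is $R$-invariant). For $X\in\Gamma(\ker F_* )$ write $RX=\phi_RX+\omega_RX$ with $\phi_RX\in\Gamma(\mathcal{D}_1)$, $\omega_RX\in\Gamma(R\mathcal{D}_2)$; for $Z\in\Gamma((\ker F_* )^{\perp})$ write $RZ=B_RZ+C_RZ$ with $B_RZ\in\Gamma(\mathcal{D}_2)$, $C_RZ\in\Gamma(\mu^R)$. $\mathcal{V},\mathcal{H}$ denote the orthogonal projections of $TM$ onto $\ker F_*$ and $(\ker F_* )^{\perp}$, and $\mathcal{T}_EG=\mathcal{H}\nabla_{\mathcal{V}E}\mathcal{V}G+\mathcal{V}\nabla_{\mathcal{V}E}\mathcal{H}G$. The second fundamental form of $F$ is $(\nabla F_* )(X,Y)=\nabla^F_XF_*Y-F_*(\nabla_XY)$, with $\nabla^F$ the pullback connection on $F^{*}TN$; $F_*\mu^R$ is the image of $\mu^R$, a subbundle of $F^{*}TN$. A distribution $\mathcal{D}$ defines a totally geodesic foliation on $M$ if $\nabla_XY\in\Gamma(\mathcal{D})$ for all $X,Y\in\Gamma(\mathcal{D})$.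 *)

theory Defs
  imports "HOL-Analysis.Analysis"
begin

section \<open>Smooth functions between finite-dimensional vector spaces\<close>

text \<open>Unlike \<open>euclidean_space\<close>, this class admits the zero space, so that
  zero-dimensional manifolds are included.\<close>

class finite_dim_inner = real_inner +
  assumes finite_dim: "\<exists>B. finite B \<and> (\<forall>x. \<exists>c. x = (\<Sum>b\<in>B. c b *\<^sub>R b))"

instance euclidean_space \<subseteq> finite_dim_inner
proof
  show "\<exists>B :: 'a set. finite B \<and> (\<forall>x. \<exists>c. x = (\<Sum>b\<in>B. c b *\<^sub>R b))"
    by (intro exI[of _ Basis] conjI finite_Basis allI exI[of _ "\<lambda>b. inner _ b"])
       (rule euclidean_representation[symmetric])
qed

primrec Ck_on :: "nat \<Rightarrow> 'a::finite_dim_inner set \<Rightarrow> ('a \<Rightarrow> 'b::real_normed_vector) \<Rightarrow> bool"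
where
  "Ck_on 0 = (\<lambda>S f. continuous_on S f)"
| "Ck_on (Suc k) = (\<lambda>S f. (\<forall>x\<in>S. f differentiable (at x)) \<and>
      (\<forall>v. Ck_on k S (\<lambda>x. frechet_derivative f (at x) v)))"

text \<open>Used only for open \<open>S\<close>.\<close>

definition smooth_on :: "'a::finite_dim_inner set \<Rightarrow> ('a \<Rightarrow> 'b::real_normed_vector) \<Rightarrow> bool"
where "smooth_on S f \<longleftrightarrow> (\<forall>k. Ck_on k S f)"

section \<open>Smooth manifolds\<close>

text \<open>The underlying set of a manifold is a whole type \<open>'m\<close>, and its smooth structure is given by
  an atlas, not necessarily maximal. A chart consists of its domain and its coordinate map; the
  values of the coordinate map outside the domain are irrelevant.\<close>

type_synonym ('m, 'e) chart = "'m set \<times> ('m \<Rightarrow> 'e)"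
type_synonym ('m, 'e) atlas = "('m, 'e) chart set"

definition is_chart :: "('m::topological_space, 'e::finite_dim_inner) chart \<Rightarrow> bool"
where "is_chart c \<longleftrightarrow> open (fst c) \<and> open (snd c ` fst c) \<and>
  (\<exists>\<psi>. homeomorphism (fst c) (snd c ` fst c) (snd c) \<psi>)"

definition chart_inv :: "('m, 'e) chart \<Rightarrow> 'e \<Rightarrow> 'm"
where "chart_inv c = inv_into (fst c) (snd c)"

definition smooth_manifold ::
  "('m::{t2_space, second_countable_topology}, 'e::finite_dim_inner) atlas \<Rightarrow> bool"
where "smooth_manifold A \<longleftrightarrow>
  (\<forall>c\<in>A. is_chart c) \<and> (\<Union>c\<in>A. fst c) = UNIV \<and>
  (\<forall>c\<in>A. \<forall>d\<in>A. smooth_on (snd c ` (fst c \<inter> fst d)) (snd d \<circ> chart_inv c))"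

definition smooth_fun_on ::
  "('m::topological_space, 'e::finite_dim_inner) atlas \<Rightarrow> 'm set \<Rightarrow> ('m \<Rightarrow> real) \<Rightarrow> bool"
where "smooth_fun_on A U f \<longleftrightarrow> (\<forall>c\<in>A. smooth_on (snd c ` (fst c \<inter> U)) (f \<circ> chart_inv c))"

definition smooth_map :: "('m::topological_space, 'e::finite_dim_inner) atlas \<Rightarrow>
  ('n::topological_space, 'f::finite_dim_inner) atlas \<Rightarrow> ('m \<Rightarrow> 'n) \<Rightarrow> bool"
where "smooth_map A B F \<longleftrightarrow> continuous_on UNIV F \<and>
  (\<forall>c\<in>A. \<forall>d\<in>B. smooth_on (snd c ` (fst c \<inter> F -` fst d)) (snd d \<circ> F \<circ> chart_inv c))"

section \<open>Tangent vectors and vector fields\<close>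

text \<open>A chart \<open>chart_at A p\<close> around every point \<open>p\<close> is chosen once and for all, and a tangent vector
  at \<open>p\<close> is represented by its components in that chart. Thus the tangent space at \<open>p\<close> is the whole
  model space \<open>'e\<close>, a vector field is a function \<open>'m \<Rightarrow> 'e\<close>, and a section of the pullback
  bundle of \<open>TN\<close> along \<open>F\<close> is a function \<open>'m \<Rightarrow> 'f\<close> whose value at \<open>p\<close> is read as a tangent vector
  at \<open>F p\<close>. As \<open>chart_at A p\<close> need not depend continuously on \<open>p\<close>, smoothness of a vector
  field is stated after passing to the components in a fixed chart.\<close>

definition chart_at :: "('m, 'e) atlas \<Rightarrow> 'm \<Rightarrow> ('m, 'e) chart"
where "chart_at A p = (SOME c. c \<in> A \<and> p \<in> fst c)"

definition components ::
  "('m, 'e::finite_dim_inner) atlas \<Rightarrow> ('m, 'e) chart \<Rightarrow> 'm \<Rightarrow> 'e \<Rightarrow> 'e"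
where "components A c p v =
  frechet_derivative (snd c \<circ> chart_inv (chart_at A p)) (at (snd (chart_at A p) p)) v"

definition vf_in_chart ::
  "('m, 'e::finite_dim_inner) atlas \<Rightarrow> ('m, 'e) chart \<Rightarrow> ('m \<Rightarrow> 'e) \<Rightarrow> 'e \<Rightarrow> 'e"
where "vf_in_chart A c X = (\<lambda>x. components A c (chart_inv c x) (X (chart_inv c x)))"

definition smooth_vf_on ::
  "('m::topological_space, 'e::finite_dim_inner) atlas \<Rightarrow> 'm set \<Rightarrow> ('m \<Rightarrow> 'e) \<Rightarrow> bool"
where "smooth_vf_on A U X \<longleftrightarrow> (\<forall>c\<in>A. smooth_on (snd c ` (fst c \<inter> U)) (vf_in_chart A c X))"

definition sections ::
  "('m::topological_space, 'e::finite_dim_inner) atlas \<Rightarrow> ('m \<Rightarrow> 'e set) \<Rightarrow> ('m \<Rightarrow> 'e) set"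
where "sections A D = {X. smooth_vf_on A UNIV X \<and> (\<forall>p. X p \<in> D p)}"

abbreviation vector_fields ::
  "('m::topological_space, 'e::finite_dim_inner) atlas \<Rightarrow> ('m \<Rightarrow> 'e) set"
where "vector_fields A \<equiv> sections A (\<lambda>_. UNIV)"

definition differential :: "('m, 'e::finite_dim_inner) atlas \<Rightarrow>
  ('n, 'f::finite_dim_inner) atlas \<Rightarrow> ('m \<Rightarrow> 'n) \<Rightarrow> 'm \<Rightarrow> 'e \<Rightarrow> 'f"
where "differential A B F p v =
  frechet_derivative (snd (chart_at B (F p)) \<circ> F \<circ> chart_inv (chart_at A p))
    (at (snd (chart_at A p) p)) v"

definition dir_deriv ::
  "('m, 'e::finite_dim_inner) atlas \<Rightarrow> ('m \<Rightarrow> 'e) \<Rightarrow> ('m \<Rightarrow> real) \<Rightarrow> 'm \<Rightarrow> real"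
where "dir_deriv A X f p =
  frechet_derivative (f \<circ> chart_inv (chart_at A p)) (at (snd (chart_at A p) p)) (X p)"

text \<open>The coordinate formula \<open>[X, Y] = DY(X) - DX(Y)\<close>, evaluated in \<open>chart_at A p\<close>.\<close>

definition lie_bracket ::
  "('m, 'e::finite_dim_inner) atlas \<Rightarrow> ('m \<Rightarrow> 'e) \<Rightarrow> ('m \<Rightarrow> 'e) \<Rightarrow> 'm \<Rightarrow> 'e"
where "lie_bracket A X Y p =
  (let c = chart_at A p in
     frechet_derivative (vf_in_chart A c Y) (at (snd c p)) (X p) -
     frechet_derivative (vf_in_chart A c X) (at (snd c p)) (Y p))"

definition distribution ::
  "('m::topological_space, 'e::finite_dim_inner) atlas \<Rightarrow> ('m \<Rightarrow> 'e set) \<Rightarrow> bool"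
where "distribution A D \<longleftrightarrow>
  (\<forall>p. \<exists>U (k::nat) E. open U \<and> p \<in> U \<and> (\<forall>i<k. smooth_vf_on A U (E i)) \<and>
    (\<forall>q\<in>U. inj_on (\<lambda>i. E i q) {..<k} \<and> independent ((\<lambda>i. E i q) ` {..<k}) \<and>
            D q = span ((\<lambda>i. E i q) ` {..<k})))"

definition endomorphism_field ::
  "('m::topological_space, 'e::finite_dim_inner) atlas \<Rightarrow> ('m \<Rightarrow> 'e \<Rightarrow> 'e) \<Rightarrow> bool"
where "endomorphism_field A R \<longleftrightarrow> (\<forall>p. linear (R p)) \<and>
  (\<forall>U X. open U \<and> smooth_vf_on A U X \<longrightarrow> smooth_vf_on A U (\<lambda>p. R p (X p)))"

section \<open>Riemannian metrics and connections\<close>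

definition riemannian_metric ::
  "('m::topological_space, 'e::finite_dim_inner) atlas \<Rightarrow> ('m \<Rightarrow> 'e \<Rightarrow> 'e \<Rightarrow> real) \<Rightarrow> bool"
where "riemannian_metric A g \<longleftrightarrow>
  (\<forall>p. bilinear (g p) \<and> (\<forall>v w. g p v w = g p w v) \<and> (\<forall>v. v \<noteq> 0 \<longrightarrow> g p v v > 0)) \<and>
  (\<forall>U X Y. open U \<and> smooth_vf_on A U X \<and> smooth_vf_on A U Y \<longrightarrow>
     smooth_fun_on A U (\<lambda>p. g p (X p) (Y p)))"

text \<open>A connection on a vector bundle over the manifold, where \<open>S\<close> is the set of smooth sections of
  the bundle. Its values on arguments that are not smooth are irrelevant.\<close>

definition connection :: "('m::topological_space, 'e::finite_dim_inner) atlas \<Rightarrow>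
  ('m \<Rightarrow> 'b::real_vector) set \<Rightarrow> (('m \<Rightarrow> 'e) \<Rightarrow> ('m \<Rightarrow> 'b) \<Rightarrow> 'm \<Rightarrow> 'b) \<Rightarrow> bool"
where "connection A S nab \<longleftrightarrow>
  (\<forall>X\<in>vector_fields A. \<forall>s\<in>S. nab X s \<in> S) \<and>
  (\<forall>X\<in>vector_fields A. \<forall>Y\<in>vector_fields A. \<forall>s\<in>S. \<forall>p.
     nab (\<lambda>q. X q + Y q) s p = nab X s p + nab Y s p) \<and>
  (\<forall>X\<in>vector_fields A. \<forall>f. \<forall>s\<in>S. \<forall>p. smooth_fun_on A UNIV f \<longrightarrow>
     nab (\<lambda>q. f q *\<^sub>R X q) s p = f p *\<^sub>R nab X s p) \<and>
  (\<forall>X\<in>vector_fields A. \<forall>s\<in>S. \<forall>t\<in>S. \<forall>p.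
     nab X (\<lambda>q. s q + t q) p = nab X s p + nab X t p) \<and>
  (\<forall>X\<in>vector_fields A. \<forall>f. \<forall>s\<in>S. \<forall>p. smooth_fun_on A UNIV f \<longrightarrow>
     nab X (\<lambda>q. f q *\<^sub>R s q) p = dir_deriv A X f p *\<^sub>R s p + f p *\<^sub>R nab X s p)"

definition levi_civita :: "('m::topological_space, 'e::finite_dim_inner) atlas \<Rightarrow>
  ('m \<Rightarrow> 'e \<Rightarrow> 'e \<Rightarrow> real) \<Rightarrow> (('m \<Rightarrow> 'e) \<Rightarrow> ('m \<Rightarrow> 'e) \<Rightarrow> 'm \<Rightarrow> 'e) \<Rightarrow> bool"
where "levi_civita A g nab \<longleftrightarrow>
  connection A (vector_fields A) nab \<and>
  (\<forall>X\<in>vector_fields A. \<forall>Y\<in>vector_fields A. \<forall>p.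
     nab X Y p - nab Y X p = lie_bracket A X Y p) \<and>
  (\<forall>X\<in>vector_fields A. \<forall>Y\<in>vector_fields A. \<forall>Z\<in>vector_fields A. \<forall>p.
     dir_deriv A X (\<lambda>q. g q (Y q) (Z q)) p = g p (nab X Y p) (Z p) + g p (Y p) (nab X Z p))"

definition sections_along :: "('m::topological_space, 'e::finite_dim_inner) atlas \<Rightarrow>
  ('n, 'f::finite_dim_inner) atlas \<Rightarrow> ('m \<Rightarrow> 'n) \<Rightarrow> ('m \<Rightarrow> 'f set) \<Rightarrow> ('m \<Rightarrow> 'f) set"
where "sections_along A B F E = {s.
  (\<forall>c\<in>A. \<forall>d\<in>B. smooth_on (snd c ` (fst c \<inter> F -` fst d))
     (\<lambda>x. components B d (F (chart_inv c x)) (s (chart_inv c x)))) \<and>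
  (\<forall>p. s p \<in> E p)}"

text \<open>The connection on the pullback bundle is characterised by its values
  \<open>nabN\<^bsub>dF(X)\<^esub> Y\<close> on the sections \<open>Y \<circ> F\<close>. Here the covariant derivative in direction of the
  vector \<open>dF(X p)\<close> is computed with any vector field \<open>Z\<close> on the target extending that vector.\<close>

definition pullback_connection :: "('m::topological_space, 'e::finite_dim_inner) atlas \<Rightarrow>
  ('n::topological_space, 'f::finite_dim_inner) atlas \<Rightarrow> ('m \<Rightarrow> 'n) \<Rightarrow>
  (('n \<Rightarrow> 'f) \<Rightarrow> ('n \<Rightarrow> 'f) \<Rightarrow> 'n \<Rightarrow> 'f) \<Rightarrow> (('m \<Rightarrow> 'e) \<Rightarrow> ('m \<Rightarrow> 'f) \<Rightarrow> 'm \<Rightarrow> 'f) \<Rightarrow> bool"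
where "pullback_connection A B F nabN nabF \<longleftrightarrow>
  connection A (sections_along A B F (\<lambda>_. UNIV)) nabF \<and>
  (\<forall>X\<in>vector_fields A. \<forall>Y\<in>vector_fields B. \<forall>Z\<in>vector_fields B. \<forall>p.
     Z (F p) = differential A B F p (X p) \<longrightarrow> nabF X (Y \<circ> F) p = nabN Z Y (F p))"

definition second_fundamental_form :: "('m, 'e::finite_dim_inner) atlas \<Rightarrow>
  ('n, 'f::finite_dim_inner) atlas \<Rightarrow> ('m \<Rightarrow> 'n) \<Rightarrow>
  (('m \<Rightarrow> 'e) \<Rightarrow> ('m \<Rightarrow> 'e) \<Rightarrow> 'm \<Rightarrow> 'e) \<Rightarrow> (('m \<Rightarrow> 'e) \<Rightarrow> ('m \<Rightarrow> 'f) \<Rightarrow> 'm \<Rightarrow> 'f) \<Rightarrow>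
  ('m \<Rightarrow> 'e) \<Rightarrow> ('m \<Rightarrow> 'e) \<Rightarrow> 'm \<Rightarrow> 'f"
where "second_fundamental_form A B F nab nabF X Y p =
  nabF X (\<lambda>q. differential A B F q (Y q)) p - differential A B F p (nab X Y p)"

definition totally_geodesic_foliation :: "('m::topological_space, 'e::finite_dim_inner) atlas \<Rightarrow>
  (('m \<Rightarrow> 'e) \<Rightarrow> ('m \<Rightarrow> 'e) \<Rightarrow> 'm \<Rightarrow> 'e) \<Rightarrow> ('m \<Rightarrow> 'e set) \<Rightarrow> bool"
where "totally_geodesic_foliation A nab D \<longleftrightarrow>
  (\<forall>X\<in>sections A D. \<forall>Y\<in>sections A D. nab X Y \<in> sections A D)"

section \<open>Hyperkaehler manifolds\<close>

definition hyperkaehler :: "('m::{t2_space, second_countable_topology}, 'e::finite_dim_inner) atlas \<Rightarrow>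
  ('m \<Rightarrow> 'e \<Rightarrow> 'e) \<Rightarrow> ('m \<Rightarrow> 'e \<Rightarrow> 'e) \<Rightarrow> ('m \<Rightarrow> 'e \<Rightarrow> 'e) \<Rightarrow>
  ('m \<Rightarrow> 'e \<Rightarrow> 'e \<Rightarrow> real) \<Rightarrow> (('m \<Rightarrow> 'e) \<Rightarrow> ('m \<Rightarrow> 'e) \<Rightarrow> 'm \<Rightarrow> 'e) \<Rightarrow> bool"
where "hyperkaehler A I J K g nab \<longleftrightarrow>
  smooth_manifold A \<and> riemannian_metric A g \<and> levi_civita A g nab \<and>
  (\<forall>p v. I p (I p v) = - v \<and> J p (J p v) = - v \<and> K p (K p v) = - v \<and>
     I p (J p v) = K p v \<and> J p (I p v) = - K p v \<and>
     J p (K p v) = I p v \<and> K p (J p v) = - I p v \<and>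
     K p (I p v) = J p v \<and> I p (K p v) = - J p v) \<and>
  (\<forall>R\<in>{I, J, K}.
     endomorphism_field A R \<and>
     (\<forall>p v w. g p (R p v) (R p w) = g p v w) \<and>
     (\<forall>X\<in>vector_fields A. \<forall>Y\<in>vector_fields A. \<forall>p.
        nab X (\<lambda>q. R q (Y q)) p = R p (nab X Y p)))"

section \<open>Horizontally conformal and semi-invariant submersions\<close>

definition ker_dist :: "('m, 'e::finite_dim_inner) atlas \<Rightarrow>
  ('n, 'f::finite_dim_inner) atlas \<Rightarrow> ('m \<Rightarrow> 'n) \<Rightarrow> 'm \<Rightarrow> 'e set"
where "ker_dist A B F p = {v. differential A B F p v = 0}"

definition ortho :: "('m \<Rightarrow> 'e \<Rightarrow> 'e \<Rightarrow> real) \<Rightarrow> ('m \<Rightarrow> 'e set) \<Rightarrow> 'm \<Rightarrow> 'e set"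
where "ortho g D p = {v. \<forall>w\<in>D p. g p v w = 0}"

definition hor_dist :: "('m, 'e::finite_dim_inner) atlas \<Rightarrow> ('m \<Rightarrow> 'e \<Rightarrow> 'e \<Rightarrow> real) \<Rightarrow>
  ('n, 'f::finite_dim_inner) atlas \<Rightarrow> ('m \<Rightarrow> 'n) \<Rightarrow> 'm \<Rightarrow> 'e set"
where "hor_dist A g B F = ortho g (ker_dist A B F)"

definition horizontally_conformal_submersion ::
  "('m::topological_space, 'e::finite_dim_inner) atlas \<Rightarrow> ('m \<Rightarrow> 'e \<Rightarrow> 'e \<Rightarrow> real) \<Rightarrow>
   ('n::topological_space, 'f::finite_dim_inner) atlas \<Rightarrow> ('n \<Rightarrow> 'f \<Rightarrow> 'f \<Rightarrow> real) \<Rightarrow>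
   ('m \<Rightarrow> 'n) \<Rightarrow> ('m \<Rightarrow> real) \<Rightarrow> bool"
where "horizontally_conformal_submersion A g B h F dil \<longleftrightarrow>
  smooth_map A B F \<and> surj F \<and> (\<forall>p. surj (differential A B F p)) \<and>
  smooth_fun_on A UNIV dil \<and> (\<forall>p. dil p > 0) \<and>
  (\<forall>p. \<forall>v\<in>hor_dist A g B F p. \<forall>w\<in>hor_dist A g B F p.
     h (F p) (differential A B F p v) (differential A B F p w) = (dil p)\<^sup>2 * g p v w)"

definition D2_dist :: "('m, 'e::finite_dim_inner) atlas \<Rightarrow> ('m \<Rightarrow> 'e \<Rightarrow> 'e \<Rightarrow> real) \<Rightarrow>
  ('n, 'f::finite_dim_inner) atlas \<Rightarrow> ('m \<Rightarrow> 'n) \<Rightarrow> ('m \<Rightarrow> 'e set) \<Rightarrow> 'm \<Rightarrow> 'e set"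
where "D2_dist A g B F D1 p = ker_dist A B F p \<inter> ortho g D1 p"

definition h_conformal_semi_invariant_submersion ::
  "('m::topological_space, 'e::finite_dim_inner) atlas \<Rightarrow>
   ('m \<Rightarrow> 'e \<Rightarrow> 'e) \<Rightarrow> ('m \<Rightarrow> 'e \<Rightarrow> 'e) \<Rightarrow> ('m \<Rightarrow> 'e \<Rightarrow> 'e) \<Rightarrow> ('m \<Rightarrow> 'e \<Rightarrow> 'e \<Rightarrow> real) \<Rightarrow>
   ('n::topological_space, 'f::finite_dim_inner) atlas \<Rightarrow> ('n \<Rightarrow> 'f \<Rightarrow> 'f \<Rightarrow> real) \<Rightarrow>
   ('m \<Rightarrow> 'n) \<Rightarrow> ('m \<Rightarrow> real) \<Rightarrow> ('m \<Rightarrow> 'e set) \<Rightarrow> bool"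
where "h_conformal_semi_invariant_submersion A I J K g B h F dil D1 \<longleftrightarrow>
  horizontally_conformal_submersion A g B h F dil \<and>
  distribution A D1 \<and> (\<forall>p. D1 p \<subseteq> ker_dist A B F p) \<and>
  (\<forall>p. ker_dist A B F p = {u + v |u v. u \<in> D1 p \<and> v \<in> D2_dist A g B F D1 p} \<and>
       D1 p \<inter> D2_dist A g B F D1 p = {0}) \<and>
  (\<forall>R\<in>{I, J, K}. \<forall>p. R p ` D1 p = D1 p \<and>
     R p ` D2_dist A g B F D1 p \<subseteq> hor_dist A g B F p)"

definition mu_dist :: "('m, 'e::finite_dim_inner) atlas \<Rightarrow> ('m \<Rightarrow> 'e \<Rightarrow> 'e \<Rightarrow> real) \<Rightarrow>
  ('n, 'f::finite_dim_inner) atlas \<Rightarrow> ('m \<Rightarrow> 'n) \<Rightarrow> ('m \<Rightarrow> 'e set) \<Rightarrow>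
  ('m \<Rightarrow> 'e \<Rightarrow> 'e) \<Rightarrow> 'm \<Rightarrow> 'e set"
where "mu_dist A g B F D1 R p =
  hor_dist A g B F p \<inter> ortho g (\<lambda>q. R q ` D2_dist A g B F D1 q) p"

text \<open>The \<open>S\<close>-part of a vector of the direct sum of \<open>S\<close> and \<open>T\<close>.\<close>

definition part_in :: "'e::real_vector set \<Rightarrow> 'e set \<Rightarrow> 'e \<Rightarrow> 'e"
where "part_in S T v = (THE a. a \<in> S \<and> (\<exists>b\<in>T. v = a + b))"

definition omega_op :: "('m, 'e::finite_dim_inner) atlas \<Rightarrow> ('m \<Rightarrow> 'e \<Rightarrow> 'e \<Rightarrow> real) \<Rightarrow>
  ('n, 'f::finite_dim_inner) atlas \<Rightarrow> ('m \<Rightarrow> 'n) \<Rightarrow> ('m \<Rightarrow> 'e set) \<Rightarrow>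
  ('m \<Rightarrow> 'e \<Rightarrow> 'e) \<Rightarrow> ('m \<Rightarrow> 'e) \<Rightarrow> 'm \<Rightarrow> 'e"
where "omega_op A g B F D1 R X p =
  part_in (R p ` D2_dist A g B F D1 p) (D1 p) (R p (X p))"

definition B_op :: "('m, 'e::finite_dim_inner) atlas \<Rightarrow> ('m \<Rightarrow> 'e \<Rightarrow> 'e \<Rightarrow> real) \<Rightarrow>
  ('n, 'f::finite_dim_inner) atlas \<Rightarrow> ('m \<Rightarrow> 'n) \<Rightarrow> ('m \<Rightarrow> 'e set) \<Rightarrow>
  ('m \<Rightarrow> 'e \<Rightarrow> 'e) \<Rightarrow> ('m \<Rightarrow> 'e) \<Rightarrow> 'm \<Rightarrow> 'e"
where "B_op A g B F D1 R Z p =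
  part_in (D2_dist A g B F D1 p) (mu_dist A g B F D1 R p) (R p (Z p))"

definition C_op :: "('m, 'e::finite_dim_inner) atlas \<Rightarrow> ('m \<Rightarrow> 'e \<Rightarrow> 'e \<Rightarrow> real) \<Rightarrow>
  ('n, 'f::finite_dim_inner) atlas \<Rightarrow> ('m \<Rightarrow> 'n) \<Rightarrow> ('m \<Rightarrow> 'e set) \<Rightarrow>
  ('m \<Rightarrow> 'e \<Rightarrow> 'e) \<Rightarrow> ('m \<Rightarrow> 'e) \<Rightarrow> 'm \<Rightarrow> 'e"
where "C_op A g B F D1 R Z p =
  part_in (mu_dist A g B F D1 R p) (D2_dist A g B F D1 p) (R p (Z p))"

definition ver :: "('m, 'e::finite_dim_inner) atlas \<Rightarrow> ('m \<Rightarrow> 'e \<Rightarrow> 'e \<Rightarrow> real) \<Rightarrow>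
  ('n, 'f::finite_dim_inner) atlas \<Rightarrow> ('m \<Rightarrow> 'n) \<Rightarrow> ('m \<Rightarrow> 'e) \<Rightarrow> 'm \<Rightarrow> 'e"
where "ver A g B F X p = part_in (ker_dist A B F p) (hor_dist A g B F p) (X p)"

definition hor :: "('m, 'e::finite_dim_inner) atlas \<Rightarrow> ('m \<Rightarrow> 'e \<Rightarrow> 'e \<Rightarrow> real) \<Rightarrow>
  ('n, 'f::finite_dim_inner) atlas \<Rightarrow> ('m \<Rightarrow> 'n) \<Rightarrow> ('m \<Rightarrow> 'e) \<Rightarrow> 'm \<Rightarrow> 'e"
where "hor A g B F X p = part_in (hor_dist A g B F p) (ker_dist A B F p) (X p)"

definition T_tensor :: "('m, 'e::finite_dim_inner) atlas \<Rightarrow> ('m \<Rightarrow> 'e \<Rightarrow> 'e \<Rightarrow> real) \<Rightarrow>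
  ('n, 'f::finite_dim_inner) atlas \<Rightarrow> ('m \<Rightarrow> 'n) \<Rightarrow>
  (('m \<Rightarrow> 'e) \<Rightarrow> ('m \<Rightarrow> 'e) \<Rightarrow> 'm \<Rightarrow> 'e) \<Rightarrow> ('m \<Rightarrow> 'e) \<Rightarrow> ('m \<Rightarrow> 'e) \<Rightarrow> 'm \<Rightarrow> 'e"
where "T_tensor A g B F nab X Y p =
  hor A g B F (nab (ver A g B F X) (ver A g B F Y)) p +
  ver A g B F (nab (ver A g B F X) (hor A g B F Y)) p"

definition condition_P ::
  "('m::topological_space, 'e::finite_dim_inner) atlas \<Rightarrow> ('m \<Rightarrow> 'e \<Rightarrow> 'e \<Rightarrow> real) \<Rightarrow>
   (('m \<Rightarrow> 'e) \<Rightarrow> ('m \<Rightarrow> 'e) \<Rightarrow> 'm \<Rightarrow> 'e) \<Rightarrow>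
   ('n::topological_space, 'f::finite_dim_inner) atlas \<Rightarrow> ('n \<Rightarrow> 'f \<Rightarrow> 'f \<Rightarrow> real) \<Rightarrow>
   (('m \<Rightarrow> 'e) \<Rightarrow> ('m \<Rightarrow> 'f) \<Rightarrow> 'm \<Rightarrow> 'f) \<Rightarrow>
   ('m \<Rightarrow> 'n) \<Rightarrow> ('m \<Rightarrow> real) \<Rightarrow> ('m \<Rightarrow> 'e set) \<Rightarrow> ('m \<Rightarrow> 'e \<Rightarrow> 'e) \<Rightarrow> bool"
where "condition_P A g nab B h nabF F dil D1 R \<longleftrightarrow>
  (\<forall>V\<in>sections A D1. \<forall>W\<in>sections A D1. \<forall>X\<in>sections A (hor_dist A g B F).
     (let S = second_fundamental_form A B F nab nabF V (\<lambda>q. R q (W q)) in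
        S \<in> sections_along A B F (\<lambda>p. differential A B F p ` mu_dist A g B F D1 R p) \<and>
        (\<forall>p. h (F p) (S p) (differential A B F p (C_op A g B F D1 R X p)) =
             (dil p)\<^sup>2 *
             g p (W p) (T_tensor A g B F nab V (omega_op A g B F D1 R (B_op A g B F D1 R X)) p))))"

end

theory Submission
  imports Defs
begin

text \<open>Fix \<open>R \<in> {I, J, K}\<close> and let \<open>V, W \<in> \<Gamma>(\<D>\<^sub>1)\<close>, \<open>N = \<nabla>\<^sub>V W\<close>. The foliation is totally geodesic iff
  always \<open>N \<in> \<D>\<^sub>1\<close>, that is, iff \<open>N\<close> is orthogonal to \<open>\<D>\<^sub>2\<close> and to the horizontal distribution. The two
  halves of \<open>(P\<^sub>R)\<close> express exactly these two orthogonalities.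

  As \<open>RW \<in> \<D>\<^sub>1\<close> is vertical and \<open>\<nabla>R = 0\<close>, the second fundamental form is \<open>(\<nabla>F\<^sub>*)(V, RW) = - F\<^sub>*(RN)\<close>
  (\<open>second_fundamental_form_eq\<close>). It lies in \<open>F\<^sub>*\<mu>\<^sup>R\<close> iff \<open>RN\<close> is orthogonal to \<open>R\<D>\<^sub>2\<close>, that is,
  \<open>N\<close> to \<open>\<D>\<^sub>2\<close> (\<open>image_Mu_iff\<close>). For horizontal \<open>X\<close>, conformality evaluates the left-hand side of
  the equation in \<open>(P\<^sub>R)\<close> as \<open>- \<lambda>\<^sup>2 g(RN, CX)\<close>. The field \<open>\<omega>BX = RBX\<close> is horizontal, so
  differentiating \<open>g(W, RBX) = 0\<close> evaluates the right-hand side as \<open>- \<lambda>\<^sup>2 g(N, RBX) = \<lambda>\<^sup>2 g(RN, BX)\<close>.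
  Since \<open>BX + CX = RX\<close>, the equation says \<open>g(RN, RX) = g(N, X) = 0\<close> (\<open>metric_equation_iff\<close>). Taking for
  \<open>X\<close> the horizontal part of \<open>N\<close> shows that this part vanishes if \<open>(P\<^sub>R)\<close> holds.

  The computation differentiates \<open>RBX\<close> and takes the horizontal part of \<open>N\<close> as a test field, so it
  rests on one analytic fact: the horizontal and vertical parts of a smooth vector field are smooth
  (\<open>hpart_smooth\<close>, \<open>vpart_smooth\<close>). Locally the vertical distribution is the common kernel of the
  component one-forms of \<open>dF\<close>, and the projection is obtained by solving Gram systems
  of smooth frames (\<open>smooth_gram_system_solvable\<close>, \<open>local_splitting\<close>). The sections on calculus and
  charts supply the closure properties of smooth functions and vector fields used there.\<close>

section \<open>Calculus of \<open>C\<^sup>k\<close> maps\<close>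

text \<open>The class \<open>finite_dim_inner\<close> provides a finite spanning set only; Gram--Schmidt turns it into an
  orthonormal basis, whose coordinates are the continuous linear functions \<open>inner _ b\<close>.\<close>

lemma orthonormal_insert:
  fixes C :: "'a::real_inner set"
  assumes "finite C" "\<And>b c. b \<in> C \<Longrightarrow> c \<in> C \<Longrightarrow> inner b c = (if b = c then 1 else 0)"
  shows "\<exists>C'. finite C' \<and> (\<forall>b\<in>C'. \<forall>c\<in>C'. inner b c = (if b = c then 1 else 0)) \<and>
    C \<subseteq> C' \<and> s \<in> span C'"
proof -
  define r where "r = s - (\<Sum>c\<in>C. inner s c *\<^sub>R c)"
  have orth_left: "inner r d = 0" if d: "d \<in> C" for d
  proof -
    have "(\<Sum>c\<in>C. inner s c * inner c d) = (\<Sum>c\<in>C. if c = d then inner s c else 0)"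
      by (rule sum.cong) (simp_all add: assms(2)[OF _ d])
    also have "\<dots> = inner s d" using d assms(1) by simp
    finally show ?thesis
      unfolding r_def by (simp add: inner_diff_left inner_sum_left)
  qed
  have orth_right: "inner d r = 0" if "d \<in> C" for d
    using orth_left[OF that] by (subst inner_commute)
  have sC: "(\<Sum>c\<in>C. inner s c *\<^sub>R c) \<in> span C"
    by (intro span_sum span_scale span_base)
  show ?thesis
  proof (cases "r = 0")
    case True
    then have "s \<in> span C" using sC by (simp add: r_def)
    then show ?thesis using assms by (intro exI[of _ C]) auto
  next
    case False
    define u where "u = r /\<^sub>R norm r"
    have u: "inner u u = 1" "\<And>d. d \<in> C \<Longrightarrow> inner u d = 0" "\<And>d. d \<in> C \<Longrightarrow> inner d u = 0"
      using False orth_left orth_right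
      by (simp_all add: u_def field_simps power2_norm_eq_inner[symmetric] power2_eq_square)
    have "r = norm r *\<^sub>R u" using False by (simp add: u_def)
    then have "s = norm r *\<^sub>R u + (\<Sum>c\<in>C. inner s c *\<^sub>R c)" by (simp add: r_def)
    moreover have "norm r *\<^sub>R u \<in> span (insert u C)" by (simp add: span_base span_scale)
    moreover have "(\<Sum>c\<in>C. inner s c *\<^sub>R c) \<in> span (insert u C)"
      using sC span_mono[of C "insert u C"] by blast
    ultimately have "s \<in> span (insert u C)" using span_add by metis
    moreover have "u \<notin> C" using u by fastforce
    ultimately show ?thesis using assms u
      by (intro exI[of _ "insert u C"]) auto
  qed
qed

lemma orthonormal_spanning:
  fixes S :: "'a::real_inner set"
  assumes "finite S"
  shows "\<exists>C. finite C \<and> (\<forall>b\<in>C. \<forall>c\<in>C. inner b c = (if b = c then 1 else 0)) \<and> S \<subseteq> span C"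
  using assms
proof induction
  case empty
  show ?case by (intro exI[of _ "{}"]) auto
next
  case (insert s S)
  then obtain C where C: "finite C" "\<forall>b\<in>C. \<forall>c\<in>C. inner b c = (if b = c then 1 else 0)" "S \<subseteq> span C"
    by blast
  then obtain C' where C': "finite C'" "\<forall>b\<in>C'. \<forall>c\<in>C'. inner b c = (if b = c then 1 else 0)"
    "C \<subseteq> C'" "s \<in> span C'"
    using orthonormal_insert[of C s] by blast
  have "insert s S \<subseteq> span C'" using C(3) span_mono[OF C'(3)] C'(4) by auto
  then show ?case using C'(1,2) by (intro exI[of _ C'] conjI)
qed

text \<open>Indexing by an initial segment of \<open>nat\<close> makes induction along the basis possible.\<close>

definition orthonormal_basis :: "nat \<Rightarrow> (nat \<Rightarrow> 'a::real_inner) \<Rightarrow> bool"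
where "orthonormal_basis n b \<longleftrightarrow>
  (\<forall>i<n. \<forall>j<n. inner (b i) (b j) = (if i = j then 1 else 0)) \<and>
  (\<forall>x. (\<Sum>i<n. inner x (b i) *\<^sub>R b i) = x)"

lemma orthonormal_basis_inner:
  "orthonormal_basis n b \<Longrightarrow> i < n \<Longrightarrow> j < n \<Longrightarrow> inner (b i) (b j) = (if i = j then 1 else 0)"
  by (simp add: orthonormal_basis_def)

lemma orthonormal_basis_exists: "\<exists>n (b::nat \<Rightarrow> 'a::finite_dim_inner). orthonormal_basis n b"
proof -
  obtain S :: "'a set" where S: "finite S" "\<forall>x. \<exists>c. x = (\<Sum>b\<in>S. c b *\<^sub>R b)"
    using finite_dim[where 'a = 'a] by (elim exE conjE) (rule that)
  obtain C where C: "finite C" "\<forall>b\<in>C. \<forall>c\<in>C. inner b c = (if b = c then 1 else 0)" "S \<subseteq> span C"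
    using orthonormal_spanning[OF S(1)] by blast
  have all: "x \<in> span C" for x
  proof -
    obtain c where "x = (\<Sum>b\<in>S. c b *\<^sub>R b)" using S(2) by blast
    then show ?thesis using C(3) by (auto intro!: span_sum span_scale)
  qed
  have expand: "x = (\<Sum>c\<in>C. inner x c *\<^sub>R c)" for x
    using all[of x]
  proof (induction rule: span_induct_alt)
    case base
    show ?case by simp
  next
    case (step a y z)
    have "(\<Sum>c\<in>C. inner (a *\<^sub>R y + z) c *\<^sub>R c) = a *\<^sub>R (\<Sum>c\<in>C. inner y c *\<^sub>R c) + z"
      by (subst (2) step(2))
         (simp add: inner_add_left scaleR_add_left sum.distrib scaleR_sum_right)
    also have "(\<Sum>c\<in>C. inner y c *\<^sub>R c) = (\<Sum>c\<in>C. if c = y then y else 0)"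
      using C(2) step(1) by (intro sum.cong) auto
    also have "\<dots> = y" using C(1) step(1) by simp
    finally show ?case by simp
  qed
  obtain h where h: "bij_betw h {0..<card C} C"
    using ex_bij_betw_nat_finite[OF C(1)] by blast
  have expand_h: "x = (\<Sum>i<card C. inner x (h i) *\<^sub>R h i)" for x
  proof -
    have "x = (\<Sum>c\<in>C. inner x c *\<^sub>R c)" by (rule expand)
    also have "\<dots> = (\<Sum>i\<in>{0..<card C}. inner x (h i) *\<^sub>R h i)"
      by (rule sum.reindex_bij_betw[OF h, symmetric])
    finally show ?thesis by (simp add: atLeast0LessThan)
  qed
  have "inner (h i) (h j) = (if i = j then 1 else 0)" if "i < card C" "j < card C" for i j
  proof -
    have "h i \<in> C" "h j \<in> C" "h i = h j \<longleftrightarrow> i = j"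
      using that h by (auto simp: bij_betw_def inj_on_def)
    then show ?thesis using C(2) by simp
  qed
  then have "orthonormal_basis (card C) h"
    unfolding orthonormal_basis_def using expand_h[symmetric] by blast
  then show ?thesis by blast
qed

lemma Ck_on_cong:
  assumes "open S" "Ck_on k S f" "\<And>x. x \<in> S \<Longrightarrow> f x = g x"
  shows "Ck_on k S g"
  using assms(2,3)
proof (induction k arbitrary: f g)
  case 0
  then show ?case by (auto intro: continuous_on_eq)
next
  case (Suc k)
  have d: "f differentiable (at x)" if "x \<in> S" for x using Suc.prems(1) that by simp
  have "g differentiable (at x)" if "x \<in> S" for x
    by (rule differentiableI[OF has_derivative_transform_within_open[OF
          iffD1[OF frechet_derivative_works d[OF that]] assms(1) that Suc.prems(2)]])
  moreover have "frechet_derivative f (at x) v = frechet_derivative g (at x) v" if "x \<in> S" for x v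
    by (rule fun_cong[OF frechet_derivative_transform_within_open[OF d[OF that] assms(1) that Suc.prems(2)]])
  then have "Ck_on k S (\<lambda>x. frechet_derivative g (at x) v)" for v
    using Suc.IH[of "\<lambda>x. frechet_derivative f (at x) v"] Suc.prems(1) by simp
  ultimately show ?case by simp
qed

text \<open>\<open>Ck_on\<close> speaks of the chosen term \<open>frechet_derivative f\<close>; this rule admits a derivative in the
  form in which the differentiation rules deliver it.\<close>

lemma Ck_on_SucI:
  assumes "open S" "\<And>x. x \<in> S \<Longrightarrow> (f has_derivative f' x) (at x)"
    and "\<And>v. Ck_on k S (\<lambda>x. f' x v)"
  shows "Ck_on (Suc k) S f"
proof -
  have "Ck_on k S (\<lambda>x. frechet_derivative f (at x) v)" for v
    by (rule Ck_on_cong[OF assms(1) assms(3)[of v]])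
       (rule fun_cong[OF frechet_derivative_at[OF assms(2)]])
  then show ?thesis using assms(2) by (auto simp: differentiable_def)
qed

lemma Ck_on_has_derivative:
  "Ck_on (Suc k) S f \<Longrightarrow> x \<in> S \<Longrightarrow> (f has_derivative frechet_derivative f (at x)) (at x)"
  by (simp add: frechet_derivative_works[symmetric])

lemma Ck_on_SucD: "Ck_on (Suc k) S f \<Longrightarrow> Ck_on k S f"
proof (induction k arbitrary: f)
  case 0
  then show ?case
    by (auto intro!: continuous_at_imp_continuous_on differentiable_imp_continuous_within)
next
  case (Suc k)
  from Suc.prems have "\<forall>x\<in>S. f differentiable (at x)"
    and "\<And>v. Ck_on (Suc k) S (\<lambda>x. frechet_derivative f (at x) v)" by simp_all
  with Suc.IH show ?case unfolding Ck_on.simps(2)[of k] by blast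
qed

lemma Ck_on_subset: "Ck_on k S f \<Longrightarrow> T \<subseteq> S \<Longrightarrow> Ck_on k T f"
  by (induction k arbitrary: f) (auto intro: continuous_on_subset)

lemma Ck_on_local:
  assumes "\<And>x. x \<in> S \<Longrightarrow> \<exists>U. open U \<and> x \<in> U \<and> Ck_on k U f"
  shows "Ck_on k S f"
  using assms
proof (induction k arbitrary: f)
  case 0
  have "continuous (at x) f" if "x \<in> S" for x
    using 0[OF that] by (auto simp: continuous_on_eq_continuous_at)
  then show ?case by (simp add: continuous_at_imp_continuous_on)
next
  case (Suc k)
  have "f differentiable (at x)" if "x \<in> S" for x using Suc.prems[OF that] by auto
  moreover have "Ck_on k S (\<lambda>x. frechet_derivative f (at x) v)" for v
  proof (rule Suc.IH)
    fix x assume "x \<in> S"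
    then obtain U where "open U" "x \<in> U" "Ck_on (Suc k) U f" using Suc.prems by blast
    then show "\<exists>U. open U \<and> x \<in> U \<and> Ck_on k U (\<lambda>x. frechet_derivative f (at x) v)"
      by (intro exI[of _ U]) simp
  qed
  ultimately show ?case by simp
qed

lemma Ck_on_const: "open S \<Longrightarrow> Ck_on k S (\<lambda>x. c)"
proof (induction k arbitrary: c)
  case (Suc k)
  show ?case
    by (rule Ck_on_SucI[where f' = "\<lambda>_ _. 0"]) (use Suc in auto)
qed simp

lemma Ck_on_add:
  "open S \<Longrightarrow> Ck_on k S f \<Longrightarrow> Ck_on k S g \<Longrightarrow> Ck_on k S (\<lambda>x. f x + g x)"
proof (induction k arbitrary: f g)
  case (Suc k)
  show ?case
  proof (rule Ck_on_SucI[OF Suc.prems(1)])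
    show "((\<lambda>x. f x + g x) has_derivative
        (\<lambda>v. frechet_derivative f (at x) v + frechet_derivative g (at x) v)) (at x)" if "x \<in> S" for x
      by (rule has_derivative_add[OF Suc.prems(2,3)[THEN Ck_on_has_derivative, OF that]])
    show "Ck_on k S (\<lambda>x. frechet_derivative f (at x) v + frechet_derivative g (at x) v)" for v
      using Suc by simp
  qed
qed (simp add: continuous_on_add)

lemma Ck_on_sum:
  "open S \<Longrightarrow> (\<And>i. i \<in> I \<Longrightarrow> Ck_on k S (f i)) \<Longrightarrow> Ck_on k S (\<lambda>x. \<Sum>i\<in>I. f i x)"
  by (induction I rule: infinite_finite_induct) (auto intro: Ck_on_const Ck_on_add)

lemma Ck_on_scaleR:
  fixes r :: "'a::finite_dim_inner \<Rightarrow> real"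
  shows "open S \<Longrightarrow> Ck_on k S r \<Longrightarrow> Ck_on k S f \<Longrightarrow> Ck_on k S (\<lambda>x. r x *\<^sub>R f x)"
proof (induction k arbitrary: r f)
  case (Suc k)
  show ?case
  proof (rule Ck_on_SucI[OF Suc.prems(1)])
    show "((\<lambda>x. r x *\<^sub>R f x) has_derivative
        (\<lambda>v. r x *\<^sub>R frechet_derivative f (at x) v + frechet_derivative r (at x) v *\<^sub>R f x)) (at x)"
      if "x \<in> S" for x
      by (rule has_derivative_scaleR[OF Suc.prems(2,3)[THEN Ck_on_has_derivative, OF that]])
    show "Ck_on k S (\<lambda>x. r x *\<^sub>R frechet_derivative f (at x) v + frechet_derivative r (at x) v *\<^sub>R f x)"
      for v
      using Suc.prems Suc.prems(2,3)[THEN Ck_on_SucD] by (intro Ck_on_add Suc.IH) simp_all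
  qed
qed (simp add: continuous_on_scaleR)

lemma Ck_on_bounded_linear:
  assumes "bounded_linear L"
  shows "open S \<Longrightarrow> Ck_on k S f \<Longrightarrow> Ck_on k S (\<lambda>x. L (f x))"
proof (induction k arbitrary: f)
  case 0
  then show ?case using bounded_linear.continuous_on[OF assms] by simp
next
  case (Suc k)
  show ?case
  proof (rule Ck_on_SucI[OF Suc.prems(1)])
    show "((\<lambda>x. L (f x)) has_derivative (\<lambda>v. L (frechet_derivative f (at x) v))) (at x)"
      if "x \<in> S" for x
      by (rule bounded_linear.has_derivative[OF assms Ck_on_has_derivative[OF Suc.prems(2) that]])
    show "Ck_on k S (\<lambda>x. L (frechet_derivative f (at x) v))" for v
      using Suc by simp
  qed
qed

lemma Ck_on_inverse:
  fixes r :: "'a::finite_dim_inner \<Rightarrow> real"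
  assumes "\<And>x. x \<in> S \<Longrightarrow> r x \<noteq> 0"
  shows "open S \<Longrightarrow> Ck_on k S r \<Longrightarrow> Ck_on k S (\<lambda>x. inverse (r x))"
proof (induction k)
  case 0
  then show ?case using assms by (simp add: continuous_on_inverse)
next
  case (Suc k)
  have r: "Ck_on k S r" using Suc.prems(2) by (rule Ck_on_SucD)
  show ?case
  proof (rule Ck_on_SucI[OF Suc.prems(1)])
    show "((\<lambda>x. inverse (r x)) has_derivative
        (\<lambda>v. - (inverse (r x) * frechet_derivative r (at x) v * inverse (r x)))) (at x)"
      if "x \<in> S" for x
      by (rule Deriv.has_derivative_inverse[OF assms[OF that] Ck_on_has_derivative[OF Suc.prems(2) that]])
    have "Ck_on k S (\<lambda>x. (-1) *\<^sub>R (inverse (r x) *\<^sub>R (frechet_derivative r (at x) v *\<^sub>R inverse (r x))))" for v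
      using Suc r by (intro Ck_on_scaleR Ck_on_const) simp_all
    then show "Ck_on k S (\<lambda>x. - (inverse (r x) * frechet_derivative r (at x) v * inverse (r x)))" for v
      by (simp add: mult.assoc)
  qed
qed

lemma linear_orthonormal_expansion:
  assumes "linear L" "orthonormal_basis n b"
  shows "(\<Sum>i<n. inner w (b i) *\<^sub>R L (b i)) = L w"
proof -
  have "(\<Sum>i<n. inner w (b i) *\<^sub>R L (b i)) = L (\<Sum>i<n. inner w (b i) *\<^sub>R b i)"
    by (simp add: linear_sum[OF assms(1)] linear_scale[OF assms(1)])
  then show ?thesis using assms(2) by (simp add: orthonormal_basis_def)
qed

text \<open>The chain rule produces the derivative of \<open>g\<close> in a direction that itself varies; expanding
  that direction in a fixed basis reduces it to the partial derivatives of \<open>g\<close>, to which the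
  induction hypothesis applies.\<close>

lemma Ck_on_compose:
  fixes f :: "'a::finite_dim_inner \<Rightarrow> 'b::finite_dim_inner"
  shows "open S \<Longrightarrow> open T \<Longrightarrow> (\<And>x. x \<in> S \<Longrightarrow> f x \<in> T) \<Longrightarrow> Ck_on k S f \<Longrightarrow> Ck_on k T g \<Longrightarrow>
    Ck_on k S (\<lambda>x. g (f x))"
proof (induction k arbitrary: g)
  case 0
  then show ?case by (auto intro: continuous_on_compose2[of T g S f])
next
  case (Suc k)
  obtain n and b :: "nat \<Rightarrow> 'b" where b: "orthonormal_basis n b"
    using orthonormal_basis_exists by blast
  note g' = Ck_on_has_derivative[OF Suc.prems(5)]
  let ?G = "\<lambda>x. frechet_derivative g (at (f x))" and ?F = "\<lambda>x. frechet_derivative f (at x)"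
  show ?case
  proof (rule Ck_on_SucI[OF Suc.prems(1)])
    show "((\<lambda>x. g (f x)) has_derivative (\<lambda>v. ?G x (?F x v))) (at x)" if "x \<in> S" for x
      by (rule has_derivative_compose[OF Ck_on_has_derivative[OF Suc.prems(4) that]
            g'[OF Suc.prems(3)[OF that]]])
    have F: "Ck_on k S (\<lambda>x. ?F x v)" for v using Suc.prems(4) by simp
    have G: "Ck_on k S (\<lambda>x. ?G x (b i))" for i
      using Suc.prems
      by (intro Suc.IH[where g = "\<lambda>y. frechet_derivative g (at y) (b i)"] Ck_on_SucD[of k S f]) simp_all
    have "Ck_on k S (\<lambda>x. \<Sum>i<n. inner (?F x v) (b i) *\<^sub>R ?G x (b i))" for v
      by (intro Ck_on_sum Ck_on_scaleR G Ck_on_bounded_linear[OF bounded_linear_inner_left] F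
            Suc.prems(1))
    moreover have "(\<Sum>i<n. inner (?F x v) (b i) *\<^sub>R ?G x (b i)) = ?G x (?F x v)" if "x \<in> S" for x v
      by (rule linear_orthonormal_expansion[OF has_derivative_linear[OF g'[OF Suc.prems(3)[OF that]]] b])
    ultimately show "Ck_on k S (\<lambda>x. ?G x (?F x v))" for v
      by (rule Ck_on_cong[OF Suc.prems(1)])
  qed
qed

section \<open>Smooth maps\<close>

lemma smooth_on_cong:
  "open S \<Longrightarrow> smooth_on S f \<Longrightarrow> (\<And>x. x \<in> S \<Longrightarrow> f x = g x) \<Longrightarrow> smooth_on S g"
  unfolding smooth_on_def using Ck_on_cong by metis

lemma smooth_on_subset: "smooth_on S f \<Longrightarrow> T \<subseteq> S \<Longrightarrow> smooth_on T f"
  unfolding smooth_on_def using Ck_on_subset by metis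

lemma smooth_on_local:
  "(\<And>x. x \<in> S \<Longrightarrow> \<exists>U. open U \<and> x \<in> U \<and> smooth_on U f) \<Longrightarrow> smooth_on S f"
  unfolding smooth_on_def by (intro allI Ck_on_local) blast

lemma smooth_on_const: "open S \<Longrightarrow> smooth_on S (\<lambda>x. c)"
  by (simp add: smooth_on_def Ck_on_const)

lemma smooth_on_add:
  "open S \<Longrightarrow> smooth_on S f \<Longrightarrow> smooth_on S g \<Longrightarrow> smooth_on S (\<lambda>x. f x + g x)"
  by (simp add: smooth_on_def Ck_on_add)

lemma smooth_on_scaleR:
  fixes r :: "'a::finite_dim_inner \<Rightarrow> real"
  shows "open S \<Longrightarrow> smooth_on S r \<Longrightarrow> smooth_on S f \<Longrightarrow> smooth_on S (\<lambda>x. r x *\<^sub>R f x)"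
  by (simp add: smooth_on_def Ck_on_scaleR)

lemma smooth_on_inverse:
  fixes r :: "'a::finite_dim_inner \<Rightarrow> real"
  shows "open S \<Longrightarrow> smooth_on S r \<Longrightarrow> (\<And>x. x \<in> S \<Longrightarrow> r x \<noteq> 0) \<Longrightarrow> smooth_on S (\<lambda>x. inverse (r x))"
  by (simp add: smooth_on_def Ck_on_inverse)

lemma smooth_on_inner_left:
  "open S \<Longrightarrow> smooth_on S f \<Longrightarrow> smooth_on S (\<lambda>x. inner (f x) b)"
  unfolding smooth_on_def using Ck_on_bounded_linear[OF bounded_linear_inner_left] by blast

lemma smooth_on_compose:
  fixes f :: "'a::finite_dim_inner \<Rightarrow> 'b::finite_dim_inner"
  shows "open S \<Longrightarrow> open T \<Longrightarrow> (\<And>x. x \<in> S \<Longrightarrow> f x \<in> T) \<Longrightarrow> smooth_on S f \<Longrightarrow> smooth_on T g \<Longrightarrow>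
    smooth_on S (\<lambda>x. g (f x))"
  unfolding smooth_on_def using Ck_on_compose by blast

lemma smooth_on_has_derivative:
  "smooth_on S f \<Longrightarrow> x \<in> S \<Longrightarrow> (f has_derivative frechet_derivative f (at x)) (at x)"
  using Ck_on_has_derivative unfolding smooth_on_def by blast

lemma smooth_on_frechet_derivative:
  "smooth_on S f \<Longrightarrow> smooth_on S (\<lambda>x. frechet_derivative f (at x) v)"
  unfolding smooth_on_def using Ck_on.simps(2) by metis

text \<open>This is the shape of the transformation law of vector fields under a change of charts, and the
  reason that the law preserves smoothness.\<close>

lemma smooth_on_derivative_along:
  fixes f :: "'a::finite_dim_inner \<Rightarrow> 'b::finite_dim_inner" and w :: "'a \<Rightarrow> 'b"
  assumes "open S" "open T" "\<And>x. x \<in> S \<Longrightarrow> f x \<in> T" "smooth_on S f" "smooth_on T g" "smooth_on S w"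
  shows "smooth_on S (\<lambda>x. frechet_derivative g (at (f x)) (w x))"
proof -
  obtain n and b :: "nat \<Rightarrow> 'b" where b: "orthonormal_basis n b"
    using orthonormal_basis_exists by blast
  have G: "smooth_on S (\<lambda>x. frechet_derivative g (at (f x)) (b i))" for i
    by (rule smooth_on_compose[OF assms(1-4) smooth_on_frechet_derivative[OF assms(5)]])
  have "smooth_on S (\<lambda>x. inner (w x) (b i) *\<^sub>R frechet_derivative g (at (f x)) (b i))" for i
    by (intro smooth_on_scaleR smooth_on_inner_left assms G)
  then have "smooth_on S (\<lambda>x. \<Sum>i<n. inner (w x) (b i) *\<^sub>R frechet_derivative g (at (f x)) (b i))"
    unfolding smooth_on_def by (intro allI Ck_on_sum[OF assms(1)]) simp
  then show ?thesis
    by (rule smooth_on_cong[OF assms(1)])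
       (rule linear_orthonormal_expansion[OF has_derivative_linear[OF
          smooth_on_has_derivative[OF assms(5) assms(3)]] b])
qed

lemma frechet_derivative_chain:
  assumes "open S" "x \<in> S" "\<And>y. y \<in> S \<Longrightarrow> u y = g (f y)"
    and "(f has_derivative f') (at x)" "(g has_derivative g') (at (f x))"
  shows "frechet_derivative u (at x) v = g' (f' v)"
proof -
  have "((\<lambda>y. g (f y)) has_derivative (\<lambda>v. g' (f' v))) (at x)"
    using has_derivative_compose[OF assms(4,5)] .
  then have "(u has_derivative (\<lambda>v. g' (f' v))) (at x)"
    by (rule has_derivative_transform_within_open[OF _ assms(1,2)]) (rule assms(3)[symmetric])
  then show ?thesis by (rule fun_cong[OF frechet_derivative_at, symmetric])
qed

section \<open>Charts and components of tangent vectors\<close>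

lemma chart_inv_left: "is_chart c \<Longrightarrow> p \<in> fst c \<Longrightarrow> chart_inv c (snd c p) = p"
  unfolding is_chart_def chart_inv_def homeomorphism_def
  by (metis inv_into_f_f inj_onI)

lemma chart_inv_right: "x \<in> snd c ` fst c \<Longrightarrow> snd c (chart_inv c x) = x"
  by (simp add: chart_inv_def f_inv_into_f)

lemma open_chart_image:
  assumes "is_chart c" "open U"
  shows "open (snd c ` (fst c \<inter> U))"
proof -
  obtain \<psi> where "homeomorphism (fst c) (snd c ` fst c) (snd c) \<psi>"
    using assms(1) by (auto simp: is_chart_def)
  then have "openin (top_of_set (snd c ` fst c)) (snd c ` (fst c \<inter> U))"
    using assms(2) by (intro homeomorphism_imp_open_map) (auto simp: openin_open)
  moreover have "open (snd c ` fst c)" using assms(1) by (simp add: is_chart_def)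
  ultimately show ?thesis by (metis openin_open_eq)
qed

lemma manifold_is_chart: "smooth_manifold A \<Longrightarrow> c \<in> A \<Longrightarrow> is_chart c"
  by (simp add: smooth_manifold_def)

lemma manifold_open_dom: "smooth_manifold A \<Longrightarrow> c \<in> A \<Longrightarrow> open (fst c)"
  by (simp add: smooth_manifold_def is_chart_def)

lemmas manifold_chart_inv = chart_inv_left[OF manifold_is_chart]
lemmas manifold_open_image = open_chart_image[OF manifold_is_chart]

lemma chart_at_in: "smooth_manifold A \<Longrightarrow> chart_at A p \<in> A"
  and chart_at_dom: "smooth_manifold A \<Longrightarrow> p \<in> fst (chart_at A p)"
proof -
  assume "smooth_manifold A"
  then have "\<exists>c. c \<in> A \<and> p \<in> fst c" unfolding smooth_manifold_def by blast
  then have "chart_at A p \<in> A \<and> p \<in> fst (chart_at A p)" unfolding chart_at_def by (rule someI_ex)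
  then show "chart_at A p \<in> A" "p \<in> fst (chart_at A p)" by simp_all
qed

lemma transition_smooth:
  "smooth_manifold A \<Longrightarrow> c \<in> A \<Longrightarrow> d \<in> A \<Longrightarrow>
    smooth_on (snd c ` (fst c \<inter> fst d)) (snd d \<circ> chart_inv c)"
  by (simp add: smooth_manifold_def)

lemma transition_has_derivative:
  assumes "smooth_manifold A" "c \<in> A" "d \<in> A" "p \<in> fst c" "p \<in> fst d"
  shows "((snd d \<circ> chart_inv c) has_derivative
    frechet_derivative (snd d \<circ> chart_inv c) (at (snd c p))) (at (snd c p))"
  by (rule smooth_on_has_derivative[OF transition_smooth[OF assms(1-3)]]) (use assms in auto)

lemma map_in_charts_has_derivative:
  assumes "smooth_map A B F" "c \<in> A" "d \<in> B" "p \<in> fst c" "F p \<in> fst d"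
  shows "((snd d \<circ> F \<circ> chart_inv c) has_derivative
    frechet_derivative (snd d \<circ> F \<circ> chart_inv c) (at (snd c p))) (at (snd c p))"
proof (rule smooth_on_has_derivative)
  show "smooth_on (snd c ` (fst c \<inter> F -` fst d)) (snd d \<circ> F \<circ> chart_inv c)"
    using assms(1-3) by (simp add: smooth_map_def)
qed (use assms in auto)

text \<open>The chain rule on a manifold: an expression in the chart \<open>c\<close> is differentiated by rewriting it
  in the chart \<open>d\<close> near \<open>p\<close>.\<close>

lemma frechet_derivative_transition_chain:
  assumes A: "smooth_manifold A" and cd: "c \<in> A" "d \<in> A" and p: "p \<in> fst c" "p \<in> fst d"
    and u: "\<And>q. q \<in> fst c \<Longrightarrow> q \<in> fst d \<Longrightarrow> u (snd c q) = g (snd d q)"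
    and g: "(g has_derivative g') (at (snd d p))"
  shows "frechet_derivative u (at (snd c p)) v =
    g' (frechet_derivative (snd d \<circ> chart_inv c) (at (snd c p)) v)"
proof (rule frechet_derivative_chain[where f = "snd d \<circ> chart_inv c" and g = g and g' = g'
      and f' = "frechet_derivative (snd d \<circ> chart_inv c) (at (snd c p))"
      and S = "snd c ` (fst c \<inter> fst d)"])
  show "open (snd c ` (fst c \<inter> fst d))"
    by (rule manifold_open_image[OF A cd(1) manifold_open_dom[OF A cd(2)]])
  show "snd c p \<in> snd c ` (fst c \<inter> fst d)" using p by auto
  show "u x = g ((snd d \<circ> chart_inv c) x)" if "x \<in> snd c ` (fst c \<inter> fst d)" for x
    using that by (auto simp: u manifold_chart_inv[OF A cd(1)])
  show "((snd d \<circ> chart_inv c) has_derivative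
      frechet_derivative (snd d \<circ> chart_inv c) (at (snd c p))) (at (snd c p))"
    by (rule transition_has_derivative[OF A cd p])
  show "(g has_derivative g') (at ((snd d \<circ> chart_inv c) (snd c p)))"
    using g by (simp add: manifold_chart_inv[OF A cd(1) p(1)])
qed

lemma components_change:
  assumes A: "smooth_manifold A" and cd: "c \<in> A" "d \<in> A" and p: "p \<in> fst c" "p \<in> fst d"
  shows "components A d p v =
    frechet_derivative (snd d \<circ> chart_inv c) (at (snd c p)) (components A c p v)"
  unfolding components_def
  by (rule frechet_derivative_transition_chain[OF A chart_at_in[OF A] cd(1) chart_at_dom[OF A] p(1)
        _ transition_has_derivative[OF A cd p]])
     (simp add: manifold_chart_inv[OF A chart_at_in[OF A]] manifold_chart_inv[OF A cd(1)])

lemma frechet_derivative_same_chart: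
  assumes "smooth_manifold A" "c \<in> A" "p \<in> fst c"
  shows "frechet_derivative (snd c \<circ> chart_inv c) (at (snd c p)) v = v"
proof -
  have "frechet_derivative id (at (snd c p)) = frechet_derivative (snd c \<circ> chart_inv c) (at (snd c p))"
    using manifold_open_image[OF assms(1,2) open_UNIV] assms(3)
    by (intro frechet_derivative_transform_within_open[of _ _ "snd c ` fst c"])
       (auto simp: chart_inv_right differentiable_def intro!: exI has_derivative_id)
  then show ?thesis by (metis frechet_derivative_id id_apply)
qed

lemma components_chart_at: "smooth_manifold A \<Longrightarrow> components A (chart_at A p) p v = v"
  unfolding components_def
  by (rule frechet_derivative_same_chart[OF _ chart_at_in chart_at_dom])

lemma linear_components:
  assumes "smooth_manifold A" "c \<in> A" "p \<in> fst c"
  shows "linear (components A c p)"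
  using has_derivative_linear[OF transition_has_derivative[OF assms(1) chart_at_in[OF assms(1)] assms(2)
        chart_at_dom[OF assms(1)] assms(3)]]
  unfolding components_def[abs_def] .

lemma linear_differential:
  assumes "smooth_manifold A" "smooth_manifold B" "smooth_map A B F"
  shows "linear (differential A B F p)"
  using has_derivative_linear[OF map_in_charts_has_derivative[OF assms(3) chart_at_in[OF assms(1)]
      chart_at_in[OF assms(2)] chart_at_dom[OF assms(1)] chart_at_dom[OF assms(2)]]]
  unfolding differential_def[abs_def] .

text \<open>Both sides are the derivative at \<open>p\<close> of \<open>d \<circ> F\<close> read in \<open>chart_at A p\<close>: on the left it passes
  through \<open>chart_at B (F p)\<close>, on the right through \<open>c\<close>. Its use is to express the differential,
  which is defined in charts that vary with \<open>p\<close>, by charts fixed in a neighbourhood.\<close>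

lemma components_differential:
  assumes A: "smooth_manifold A" and B: "smooth_manifold B" and F: "smooth_map A B F"
    and c: "c \<in> A" "p \<in> fst c" and d: "d \<in> B" "F p \<in> fst d"
  shows "components B d (F p) (differential A B F p v) =
    frechet_derivative (snd d \<circ> F \<circ> chart_inv c) (at (snd c p)) (components A c p v)"
proof -
  let ?a = "chart_at A p" and ?b = "chart_at B (F p)"
  let ?u = "snd d \<circ> F \<circ> chart_inv ?a"
  note a = chart_at_in[OF A, of p] chart_at_dom[OF A, of p]
  note b = chart_at_in[OF B, of "F p"] chart_at_dom[OF B, of "F p"]
  have pre: "open (F -` V)" if "open V" for V
    using F that by (simp add: smooth_map_def continuous_on_open_vimage)
  let ?S = "snd ?a ` (fst ?a \<inter> (F -` (fst ?b \<inter> fst d)))"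
  have "frechet_derivative ?u (at (snd ?a p)) v =
      frechet_derivative (snd d \<circ> chart_inv ?b) (at (snd ?b (F p)))
        (frechet_derivative (snd ?b \<circ> F \<circ> chart_inv ?a) (at (snd ?a p)) v)"
  proof (rule frechet_derivative_chain[where S = ?S and f = "snd ?b \<circ> F \<circ> chart_inv ?a"
        and f' = "frechet_derivative (snd ?b \<circ> F \<circ> chart_inv ?a) (at (snd ?a p))"
        and g = "snd d \<circ> chart_inv ?b"
        and g' = "frechet_derivative (snd d \<circ> chart_inv ?b) (at (snd ?b (F p)))"])
    show "open ?S"
      by (intro manifold_open_image[OF A a(1)] pre open_Int manifold_open_dom[OF B] b(1) d(1))
    show "snd ?a p \<in> ?S" using a b d by auto
    show "?u x = (snd d \<circ> chart_inv ?b) ((snd ?b \<circ> F \<circ> chart_inv ?a) x)" if "x \<in> ?S" for x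
      using that by (auto simp: manifold_chart_inv[OF A a(1)] manifold_chart_inv[OF B b(1)])
    show "((snd ?b \<circ> F \<circ> chart_inv ?a) has_derivative
        frechet_derivative (snd ?b \<circ> F \<circ> chart_inv ?a) (at (snd ?a p))) (at (snd ?a p))"
      by (rule map_in_charts_has_derivative[OF F a(1) b(1) a(2) b(2)])
    show "((snd d \<circ> chart_inv ?b) has_derivative
        frechet_derivative (snd d \<circ> chart_inv ?b) (at (snd ?b (F p))))
        (at ((snd ?b \<circ> F \<circ> chart_inv ?a) (snd ?a p)))"
      using transition_has_derivative[OF B b(1) d(1) b(2) d(2)]
      by (simp add: manifold_chart_inv[OF A a])
  qed
  moreover have "frechet_derivative ?u (at (snd ?a p)) v =
      frechet_derivative (snd d \<circ> F \<circ> chart_inv c) (at (snd c p))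
        (frechet_derivative (snd c \<circ> chart_inv ?a) (at (snd ?a p)) v)"
    by (rule frechet_derivative_transition_chain[OF A a(1) c(1) a(2) c(2) _
          map_in_charts_has_derivative[OF F c(1) d(1) c(2) d(2)]])
       (simp add: manifold_chart_inv[OF A a(1)] manifold_chart_inv[OF A c(1)])
  ultimately show ?thesis by (simp add: components_def differential_def)
qed

section \<open>Local smoothness of functions and vector fields\<close>

lemma smooth_vf_on_subset: "smooth_vf_on A U X \<Longrightarrow> V \<subseteq> U \<Longrightarrow> smooth_vf_on A V X"
  unfolding smooth_vf_on_def by (blast intro: smooth_on_subset)

lemma vf_in_chart_at: "is_chart c \<Longrightarrow> p \<in> fst c \<Longrightarrow> vf_in_chart A c X (snd c p) = components A c p (X p)"
  by (simp add: vf_in_chart_def chart_inv_left)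

lemma smooth_vf_on_cong:
  assumes A: "smooth_manifold A" and "open U" "smooth_vf_on A U X" "\<And>p. p \<in> U \<Longrightarrow> X p = Y p"
  shows "smooth_vf_on A U Y"
  unfolding smooth_vf_on_def
proof
  fix c assume c: "c \<in> A"
  show "smooth_on (snd c ` (fst c \<inter> U)) (vf_in_chart A c Y)"
    by (rule smooth_on_cong[OF manifold_open_image[OF A c assms(2)], of "vf_in_chart A c X"])
       (use assms(3,4) c in \<open>auto simp: smooth_vf_on_def vf_in_chart_at[OF manifold_is_chart[OF A c]]\<close>)
qed

lemma smooth_vf_on_local:
  assumes A: "smooth_manifold A" and "\<And>p. p \<in> V \<Longrightarrow> \<exists>U. open U \<and> p \<in> U \<and> smooth_vf_on A U X"
  shows "smooth_vf_on A V X"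
  unfolding smooth_vf_on_def
proof (intro ballI smooth_on_local)
  fix c x assume c: "c \<in> A" and "x \<in> snd c ` (fst c \<inter> V)"
  then obtain p where p: "p \<in> fst c" "p \<in> V" "x = snd c p" by auto
  then obtain U where U: "open U" "p \<in> U" "smooth_vf_on A U X" using assms(2) by blast
  then show "\<exists>U. open U \<and> x \<in> U \<and> smooth_on U (vf_in_chart A c X)"
    using p c manifold_open_image[OF A c U(1)]
    by (intro exI[of _ "snd c ` (fst c \<inter> U)"]) (auto simp: smooth_vf_on_def)
qed

lemma smooth_vf_on_zero:
  assumes A: "smooth_manifold A" and U: "open U"
  shows "smooth_vf_on A U (\<lambda>_. 0)"
  unfolding smooth_vf_on_def
proof
  fix c assume c: "c \<in> A"
  show "smooth_on (snd c ` (fst c \<inter> U)) (vf_in_chart A c (\<lambda>_. 0))"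
    by (rule smooth_on_cong[OF manifold_open_image[OF A c U] smooth_on_const[of _ 0]])
       (auto intro: manifold_open_image[OF A c U]
         simp: vf_in_chart_at[OF manifold_is_chart[OF A c]] linear_0[OF linear_components[OF A c]])
qed

lemma smooth_vf_on_add:
  assumes A: "smooth_manifold A" and U: "open U" and XY: "smooth_vf_on A U X" "smooth_vf_on A U Y"
  shows "smooth_vf_on A U (\<lambda>p. X p + Y p)"
  unfolding smooth_vf_on_def
proof
  fix c assume c: "c \<in> A"
  note o = manifold_open_image[OF A c U]
  show "smooth_on (snd c ` (fst c \<inter> U)) (vf_in_chart A c (\<lambda>p. X p + Y p))"
    by (rule smooth_on_cong[OF o smooth_on_add[OF o, of "vf_in_chart A c X" "vf_in_chart A c Y"]])
       (use XY c in \<open>auto simp: smooth_vf_on_def vf_in_chart_at[OF manifold_is_chart[OF A c]]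
          linear_add[OF linear_components[OF A c]]\<close>)
qed

lemma smooth_vf_on_scaleR:
  assumes A: "smooth_manifold A" and U: "open U" and X: "smooth_fun_on A U f" "smooth_vf_on A U X"
  shows "smooth_vf_on A U (\<lambda>p. f p *\<^sub>R X p)"
  unfolding smooth_vf_on_def
proof
  fix c assume c: "c \<in> A"
  note o = manifold_open_image[OF A c U]
  show "smooth_on (snd c ` (fst c \<inter> U)) (vf_in_chart A c (\<lambda>p. f p *\<^sub>R X p))"
    by (rule smooth_on_cong[OF o smooth_on_scaleR[OF o, of "f \<circ> chart_inv c" "vf_in_chart A c X"]])
       (use X c in \<open>auto simp: smooth_vf_on_def smooth_fun_on_def vf_in_chart_at[OF manifold_is_chart[OF A c]]
          linear_scale[OF linear_components[OF A c]] manifold_chart_inv[OF A c]\<close>)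
qed

lemma smooth_fun_on_const:
  "smooth_manifold A \<Longrightarrow> open U \<Longrightarrow> smooth_fun_on A U (\<lambda>_. r)"
  unfolding smooth_fun_on_def o_def by (auto intro: smooth_on_const manifold_open_image)

lemma smooth_vf_on_diff:
  assumes A: "smooth_manifold A" and U: "open U" and XY: "smooth_vf_on A U X" "smooth_vf_on A U Y"
  shows "smooth_vf_on A U (\<lambda>p. X p - Y p)"
  using smooth_vf_on_add[OF A U XY(1) smooth_vf_on_scaleR[OF A U smooth_fun_on_const[OF A U, of "-1"] XY(2)]]
  by simp

lemma smooth_fun_on_diff:
  assumes A: "smooth_manifold A" and U: "open U" and "smooth_fun_on A U f" "smooth_fun_on A U h"
  shows "smooth_fun_on A U (\<lambda>p. f p - h p)"
  unfolding smooth_fun_on_def o_def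
proof
  fix c assume c: "c \<in> A"
  note o = manifold_open_image[OF A c U]
  have "smooth_on (snd c ` (fst c \<inter> U))
      (\<lambda>x. f (chart_inv c x) + (-1) *\<^sub>R h (chart_inv c x))"
    using assms c by (intro smooth_on_add smooth_on_scaleR smooth_on_const o) (simp_all add: smooth_fun_on_def o_def)
  then show "smooth_on (snd c ` (fst c \<inter> U)) (\<lambda>x. f (chart_inv c x) - h (chart_inv c x))" by simp
qed

lemma smooth_fun_on_divide:
  assumes A: "smooth_manifold A" and U: "open U" and "smooth_fun_on A U f" "smooth_fun_on A U h"
    and "\<And>p. p \<in> U \<Longrightarrow> h p \<noteq> 0"
  shows "smooth_fun_on A U (\<lambda>p. f p / h p)"
  unfolding smooth_fun_on_def o_def
proof
  fix c assume c: "c \<in> A"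
  note o = manifold_open_image[OF A c U]
  have "smooth_on (snd c ` (fst c \<inter> U)) (\<lambda>x. f (chart_inv c x) *\<^sub>R inverse (h (chart_inv c x)))"
    using assms c by (intro smooth_on_scaleR smooth_on_inverse o)
      (auto simp: smooth_fun_on_def o_def manifold_chart_inv[OF A c])
  then show "smooth_on (snd c ` (fst c \<inter> U)) (\<lambda>x. f (chart_inv c x) / h (chart_inv c x))"
    by (simp add: field_simps)
qed

lemma transition_chart_image:
  assumes A: "smooth_manifold A" and cd: "c \<in> A" "d \<in> A" and U: "U \<subseteq> fst c"
    and x: "x \<in> snd d ` (fst d \<inter> U)"
  shows "(snd c \<circ> chart_inv d) x \<in> snd c ` U"
  using x U by (auto simp: manifold_chart_inv[OF A cd(2)])

text \<open>Smoothness on a chart domain may be tested in that chart alone, because the components in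
  any other chart arise by composition with a transition map and, for vector fields, by applying
  its derivative.\<close>

lemma smooth_fun_on_chartI:
  assumes A: "smooth_manifold A" and c: "c \<in> A" and U: "open U" "U \<subseteq> fst c"
    and f: "smooth_on (snd c ` U) (f \<circ> chart_inv c)"
  shows "smooth_fun_on A U f"
  unfolding smooth_fun_on_def
proof
  fix d assume d: "d \<in> A"
  let ?S = "snd d ` (fst d \<inter> U)" and ?t = "snd c \<circ> chart_inv d"
  have o: "open ?S" "open (snd c ` U)"
    using manifold_open_image[OF A d U(1)] manifold_open_image[OF A c U(1)] U(2)
    by (auto simp: Int_absorb1)
  have t: "smooth_on ?S ?t"
    by (rule smooth_on_subset[OF transition_smooth[OF A d c]]) (use U in auto)
  show "smooth_on ?S (f \<circ> chart_inv d)"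
    by (rule smooth_on_cong[OF o(1) smooth_on_compose[OF o transition_chart_image[OF A c d U(2)] t f]])
       (use U(2) in \<open>auto simp: manifold_chart_inv[OF A d] manifold_chart_inv[OF A c]\<close>)
qed

lemma smooth_vf_on_chartI:
  assumes A: "smooth_manifold A" and c: "c \<in> A" and U: "open U" "U \<subseteq> fst c"
    and X: "smooth_on (snd c ` U) (vf_in_chart A c X)"
  shows "smooth_vf_on A U X"
  unfolding smooth_vf_on_def
proof
  fix d assume d: "d \<in> A"
  let ?S = "snd d ` (fst d \<inter> U)" and ?t = "snd c \<circ> chart_inv d"
  have o: "open ?S" "open (snd c ` U)"
    using manifold_open_image[OF A d U(1)] manifold_open_image[OF A c U(1)] U(2)
    by (auto simp: Int_absorb1)
  note im = transition_chart_image[OF A c d U(2)]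
  have t: "smooth_on ?S ?t"
    by (rule smooth_on_subset[OF transition_smooth[OF A d c]]) (use U in auto)
  have s: "smooth_on (snd c ` (fst c \<inter> fst d)) (snd d \<circ> chart_inv c)"
    by (rule transition_smooth[OF A c d])
  have os: "open (snd c ` (fst c \<inter> fst d))"
    by (rule manifold_open_image[OF A c manifold_open_dom[OF A d]])
  have ims: "?t x \<in> snd c ` (fst c \<inter> fst d)" if "x \<in> ?S" for x
    using that U(2) by (auto simp: manifold_chart_inv[OF A d])
  have "smooth_on ?S (\<lambda>x. frechet_derivative (snd d \<circ> chart_inv c) (at (?t x)) (vf_in_chart A c X (?t x)))"
    by (rule smooth_on_derivative_along[OF o(1) os ims t s smooth_on_compose[OF o im t X]])
  then show "smooth_on ?S (vf_in_chart A d X)"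
  proof (rule smooth_on_cong[OF o(1)])
    fix x assume "x \<in> ?S"
    then obtain p where p: "p \<in> fst d" "p \<in> fst c" "x = snd d p" using U(2) by auto
    then show "frechet_derivative (snd d \<circ> chart_inv c) (at (?t x)) (vf_in_chart A c X (?t x)) =
        vf_in_chart A d X x"
      by (simp add: manifold_chart_inv[OF A d] vf_in_chart_at[OF manifold_is_chart[OF A d]]
          vf_in_chart_at[OF manifold_is_chart[OF A c]] components_change[OF A c d p(2,1)])
  qed
qed

text \<open>The vector field on a chart domain whose components in that chart are constantly \<open>b\<close>.\<close>

definition coordinate_field ::
  "('m, 'e::finite_dim_inner) atlas \<Rightarrow> ('m, 'e) chart \<Rightarrow> 'e \<Rightarrow> 'm \<Rightarrow> 'e"
where "coordinate_field A c b p =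
  frechet_derivative (snd (chart_at A p) \<circ> chart_inv c) (at (snd c p)) b"

lemma coordinate_field_components:
  assumes A: "smooth_manifold A" and c: "c \<in> A" "p \<in> fst c"
  shows "coordinate_field A c (components A c p v) p = v"
  using components_change[OF A c(1) chart_at_in[OF A] c(2) chart_at_dom[OF A], of v]
  by (simp add: coordinate_field_def components_chart_at[OF A])

lemma components_coordinate_field:
  assumes A: "smooth_manifold A" and c: "c \<in> A" "p \<in> fst c"
  shows "components A c p (coordinate_field A c b p) = b"
proof -
  let ?a = "chart_at A p"
  note a = chart_at_in[OF A, of p] chart_at_dom[OF A, of p]
  have "frechet_derivative (snd c \<circ> chart_inv c) (at (snd c p)) b =
    frechet_derivative (snd c \<circ> chart_inv ?a) (at (snd ?a p))
      (frechet_derivative (snd ?a \<circ> chart_inv c) (at (snd c p)) b)"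
    by (rule frechet_derivative_transition_chain[OF A c(1) a(1) c(2) a(2) _
          transition_has_derivative[OF A a(1) c(1) a(2) c(2)]])
       (simp add: manifold_chart_inv[OF A c(1)] manifold_chart_inv[OF A a(1)])
  then show ?thesis
    by (simp add: coordinate_field_def components_def frechet_derivative_same_chart[OF A c])
qed

lemma smooth_coordinate_field:
  assumes A: "smooth_manifold A" and c: "c \<in> A" and U: "open U" "U \<subseteq> fst c"
  shows "smooth_vf_on A U (coordinate_field A c b)"
proof (rule smooth_vf_on_chartI[OF A c U])
  have "open (snd c ` U)" using manifold_open_image[OF A c U(1)] U(2) by (simp add: Int_absorb1)
  then show "smooth_on (snd c ` U) (vf_in_chart A c (coordinate_field A c b))"
    by (rule smooth_on_cong[OF _ smooth_on_const[of _ b]])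
       (use U(2) in \<open>auto simp: vf_in_chart_at[OF manifold_is_chart[OF A c]]
          components_coordinate_field[OF A c] intro: \<open>open (snd c ` U)\<close>\<close>)
qed

lemma zero_section_along:
  assumes A: "smooth_manifold A" and B: "smooth_manifold B" and F: "smooth_map A B F"
    and 0: "\<And>p. 0 \<in> E p"
  shows "(\<lambda>_. 0) \<in> sections_along A B F E"
proof -
  have "smooth_on (snd c ` (fst c \<inter> F -` fst d))
      (\<lambda>x. components B d (F (chart_inv c x)) 0)" if c: "c \<in> A" and d: "d \<in> B" for c d
  proof -
    have "open (F -` fst d)"
      using F manifold_open_dom[OF B d] by (simp add: smooth_map_def continuous_on_open_vimage)
    then have "open (snd c ` (fst c \<inter> F -` fst d))" by (rule manifold_open_image[OF A c])
    then show ?thesis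
      by (rule smooth_on_cong[OF _ smooth_on_const[of _ 0]])
         (auto simp: manifold_chart_inv[OF A c] linear_0[OF linear_components[OF B d]]
            intro: \<open>open (snd c ` (fst c \<inter> F -` fst d))\<close>)
  qed
  then show ?thesis using 0 by (simp add: sections_along_def)
qed

section \<open>Riemannian metrics and smooth frames\<close>

lemma metric_bilinear: "riemannian_metric A g \<Longrightarrow> bilinear (g p)"
  and metric_sym: "riemannian_metric A g \<Longrightarrow> g p v w = g p w v"
  and metric_pos: "riemannian_metric A g \<Longrightarrow> v \<noteq> 0 \<Longrightarrow> g p v v > 0"
  and metric_smooth: "riemannian_metric A g \<Longrightarrow> open U \<Longrightarrow> smooth_vf_on A U X \<Longrightarrow>
    smooth_vf_on A U Y \<Longrightarrow> smooth_fun_on A U (\<lambda>p. g p (X p) (Y p))"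
  unfolding riemannian_metric_def by blast+

lemma metric_linear_right: "riemannian_metric A g \<Longrightarrow> linear (g p v)"
  using metric_bilinear by (auto simp: bilinear_def)

lemma metric_zero_on_span:
  assumes "riemannian_metric A g" "\<And>s. s \<in> S \<Longrightarrow> g p v s = 0" "w \<in> span S"
  shows "g p v w = 0"
  using linear_eq_0_on_span[OF metric_linear_right[OF assms(1)] assms(2,3)] .

lemma metric_simps:
  assumes "riemannian_metric A g"
  shows "g p (v + v') w = g p v w + g p v' w" "g p w (v + v') = g p w v + g p w v'"
    "g p (v - v') w = g p v w - g p v' w" "g p w (v - v') = g p w v - g p w v'"
    "g p (r *\<^sub>R v) w = r * g p v w" "g p w (r *\<^sub>R v) = r * g p w v"
    "g p (- v) w = - g p v w" "g p w (- v) = - g p w v" "g p 0 w = 0" "g p w 0 = 0"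
  using metric_bilinear[OF assms, of p]
  by (simp_all add: bilinear_ladd bilinear_radd bilinear_lsub bilinear_rsub bilinear_lmul bilinear_rmul
      bilinear_lneg bilinear_rneg bilinear_lzero bilinear_rzero)

text \<open>The Gram system of a pointwise independent frame is solved by induction on the length of the
  frame rather than by inverting the Gram matrix: subtracting from the last frame field its
  projection to the span of the others leaves a nowhere vanishing field \<open>n\<close> orthogonal to them, and
  a multiple of \<open>n\<close> corrects the last equation without disturbing the others. The projection is
  itself a solution of a shorter Gram system. All divisions are by \<open>g(n, n) > 0\<close>, so
  smoothness is preserved.\<close>

lemma smooth_gram_system_solvable:
  fixes k :: nat
  assumes A: "smooth_manifold A" and g: "riemannian_metric A g" and U: "open U"
  shows "(\<And>i. i < k \<Longrightarrow> smooth_vf_on A U (E i)) \<Longrightarrow>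
    (\<And>i q. i < k \<Longrightarrow> q \<in> U \<Longrightarrow> E i q \<notin> span ((\<lambda>j. E j q) ` {..<i})) \<Longrightarrow>
    (\<And>i. i < k \<Longrightarrow> smooth_fun_on A U (a i)) \<Longrightarrow>
    \<exists>Y. smooth_vf_on A U Y \<and> (\<forall>q\<in>U. Y q \<in> span ((\<lambda>j. E j q) ` {..<k}) \<and>
      (\<forall>i<k. g q (Y q) (E i q) = a i q))"
proof (induction k arbitrary: a)
  case 0
  show ?case using smooth_vf_on_zero[OF A U] by (intro exI[of _ "\<lambda>_. 0"]) auto
next
  case (Suc k)
  note E = Suc.prems(1) and indep = Suc.prems(2) and a = Suc.prems(3)
  let ?S = "\<lambda>q. span ((\<lambda>j. E j q) ` {..<k})"
  have solve: "\<exists>Y. smooth_vf_on A U Y \<and> (\<forall>q\<in>U. Y q \<in> ?S q \<and> (\<forall>i<k. g q (Y q) (E i q) = b i q))"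
    if "\<And>i. i < k \<Longrightarrow> smooth_fun_on A U (b i)" for b
    by (rule Suc.IH[OF E indep that]) auto
  obtain P where P: "smooth_vf_on A U P" "\<And>q. q \<in> U \<Longrightarrow> P q \<in> ?S q"
    "\<And>q i. q \<in> U \<Longrightarrow> i < k \<Longrightarrow> g q (P q) (E i q) = g q (E k q) (E i q)"
    using solve[of "\<lambda>i q. g q (E k q) (E i q)"] metric_smooth[OF g U] E by force
  obtain Y where Y: "smooth_vf_on A U Y" "\<And>q. q \<in> U \<Longrightarrow> Y q \<in> ?S q"
    "\<And>q i. q \<in> U \<Longrightarrow> i < k \<Longrightarrow> g q (Y q) (E i q) = a i q"
    using solve[of a] a by force
  \<comment> \<open>\<open>n\<close> is the component of \<open>E k\<close> orthogonal to the earlier fields, and \<open>c\<close> is the multiple of it that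
    makes the equation for \<open>E k\<close> hold.\<close>
  define n where "n q = E k q - P q" for q
  define c where "c q = (a k q - g q (Y q) (E k q)) / g q (n q) (n q)" for q
  have sn: "smooth_vf_on A U n"
    unfolding n_def by (intro smooth_vf_on_diff[OF A U] E P(1)) simp
  have orth: "g q (n q) w = 0" if "q \<in> U" "w \<in> ?S q" for q w
    by (rule metric_zero_on_span[OF g _ that(2)]) (auto simp: n_def metric_simps[OF g] P(3)[OF that(1)])
  have nz: "g q (n q) (n q) > 0" if "q \<in> U" for q
  proof (rule metric_pos[OF g])
    show "n q \<noteq> 0" using indep[of k q] P(2)[OF that] that by (auto simp: n_def)
  qed
  have nE: "g q (n q) (E k q) = g q (n q) (n q)" if "q \<in> U" for q
    using orth[OF that P(2)[OF that]] by (simp add: n_def metric_simps[OF g])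
  have "smooth_vf_on A U (\<lambda>q. Y q + c q *\<^sub>R n q)"
    unfolding c_def
    by (intro smooth_vf_on_add[OF A U] smooth_vf_on_scaleR[OF A U] smooth_fun_on_divide[OF A U]
          smooth_fun_on_diff[OF A U] metric_smooth[OF g U] Y(1) sn E a)
       (use nz in \<open>auto simp: less_imp_neq[symmetric] dest: less_imp_neq\<close>)
  moreover have "Y q + c q *\<^sub>R n q \<in> span ((\<lambda>j. E j q) ` {..<Suc k})" if q: "q \<in> U" for q
  proof -
    have sub: "?S q \<subseteq> span ((\<lambda>j. E j q) ` {..<Suc k})" by (intro span_mono) auto
    have "E k q \<in> span ((\<lambda>j. E j q) ` {..<Suc k})" by (intro span_base) auto
    then show ?thesis
      using sub P(2)[OF q] Y(2)[OF q] unfolding n_def by (intro span_add span_scale span_diff) auto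
  qed
  moreover have "g q (Y q + c q *\<^sub>R n q) (E i q) = a i q" if q: "q \<in> U" and "i < Suc k" for q i
  proof (cases "i = k")
    case True
    then show ?thesis using nz[OF q] by (simp add: metric_simps[OF g] nE[OF q] c_def)
  next
    case False
    then have i: "i < k" using that by simp
    then have "g q (n q) (E i q) = 0" by (intro orth[OF q] span_base) auto
    then show ?thesis by (simp add: metric_simps[OF g] Y(3)[OF q i])
  qed
  ultimately show ?case by (intro exI[of _ "\<lambda>q. Y q + c q *\<^sub>R n q"]) auto
qed

lemma coordinate_frame_spans:
  assumes A: "smooth_manifold A" and c: "c \<in> A" "q \<in> fst c" and b: "orthonormal_basis n b"
  shows "v \<in> span ((\<lambda>i. coordinate_field A c (b i) q) ` {..<n})"
proof -
  let ?L = "components A c q" and ?E = "\<lambda>i. coordinate_field A c (b i) q"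
  let ?w = "\<Sum>i<n. inner (?L v) (b i) *\<^sub>R ?E i"
  note lin = linear_components[OF A c]
  have "?L ?w = (\<Sum>i<n. inner (?L v) (b i) *\<^sub>R b i)"
    by (simp add: linear_sum[OF lin] linear_scale[OF lin] components_coordinate_field[OF A c])
  also have "\<dots> = ?L v" using b by (simp add: orthonormal_basis_def)
  finally have "?w = v" by (metis coordinate_field_components[OF A c])
  moreover have "?w \<in> span (?E ` {..<n})" by (intro span_sum span_scale span_base) auto
  ultimately show ?thesis by simp
qed

text \<open>The \<open>i\<close>-th component is a linear functional that separates the \<open>i\<close>-th field from the earlier ones.\<close>

lemma coordinate_frame_independent:
  assumes A: "smooth_manifold A" and c: "c \<in> A" "q \<in> fst c" and b: "orthonormal_basis n b" and "i < n"
  shows "coordinate_field A c (b i) q \<notin> span ((\<lambda>j. coordinate_field A c (b j) q) ` {..<i})"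
proof
  let ?\<phi> = "\<lambda>v. inner (components A c q v) (b i)"
  assume *: "coordinate_field A c (b i) q \<in> span ((\<lambda>j. coordinate_field A c (b j) q) ` {..<i})"
  have "linear ?\<phi>"
    using linear_components[OF A c] by (auto simp: linear_iff inner_add_left)
  then have "?\<phi> (coordinate_field A c (b i) q) = 0"
    by (rule linear_eq_0_on_span[OF _ _ *])
       (use orthonormal_basis_inner[OF b] \<open>i < n\<close> in \<open>auto simp: components_coordinate_field[OF A c]\<close>)
  then show False
    using orthonormal_basis_inner[OF b \<open>i < n\<close> \<open>i < n\<close>] by (simp add: components_coordinate_field[OF A c])
qed

section \<open>The horizontal and vertical parts of a smooth vector field\<close>

text \<open>Orthogonal subspaces meet in \<open>0\<close> because \<open>g\<close> is positive definite, so the decomposition that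
  \<open>part_in\<close> selects is unique.\<close>

lemma part_in_orthogonal:
  assumes g: "riemannian_metric A g" and ST: "subspace S" "subspace T" "\<And>s t. s \<in> S \<Longrightarrow> t \<in> T \<Longrightarrow> g p s t = 0"
    and ab: "a \<in> S" "b \<in> T" "v = a + b"
  shows "part_in S T v = a"
  unfolding part_in_def
proof (rule the_equality)
  show "a \<in> S \<and> (\<exists>b\<in>T. v = a + b)" using ab by blast
  fix a' assume "a' \<in> S \<and> (\<exists>b\<in>T. v = a' + b)"
  then obtain b' where b': "a' \<in> S" "b' \<in> T" "v = a' + b'" by blast
  have "g p (a' - a) (b - b') = 0" by (intro ST subspace_diff ab b')
  moreover have "b - b' = a' - a" using ab(3) b'(3) by (simp add: algebra_simps)
  ultimately have "g p (a' - a) (a' - a) = 0" by simp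
  then show "a' = a" using metric_pos[OF g, of "a' - a" p] by force
qed

locale submersion_from_riemannian =
  fixes A :: "('m::{t2_space, second_countable_topology}, 'e::finite_dim_inner) atlas"
    and B :: "('n::{t2_space, second_countable_topology}, 'f::finite_dim_inner) atlas"
    and g :: "'m \<Rightarrow> 'e \<Rightarrow> 'e \<Rightarrow> real"
    and F :: "'m \<Rightarrow> 'n"
  assumes A: "smooth_manifold A" and B: "smooth_manifold B"
    and g: "riemannian_metric A g"
    and F: "smooth_map A B F"
    and surj_dF: "surj (differential A B F p)"
begin

abbreviation "dF \<equiv> differential A B F"
abbreviation "Ver \<equiv> ker_dist A B F"
abbreviation "Hor \<equiv> hor_dist A g B F"
abbreviation "hpart \<equiv> hor A g B F"
abbreviation "vpart \<equiv> ver A g B F"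

lemmas lin_dF = linear_differential[OF A B F]
lemmas g_simps = metric_simps[OF g]
lemmas g_sym = metric_sym[OF g]

lemma subspace_ortho: "subspace (ortho g D p)"
  by (auto simp: subspace_def ortho_def g_simps)

lemma subspace_Ver: "subspace (Ver p)"
  using lin_dF by (auto simp: subspace_def ker_dist_def linear_0 linear_add linear_scale)

lemma subspace_Hor: "subspace (Hor p)"
  unfolding hor_dist_def by (rule subspace_ortho)

lemma Hor_Ver: "v \<in> Hor p \<Longrightarrow> w \<in> Ver p \<Longrightarrow> g p v w = 0"
  and Ver_Hor: "w \<in> Ver p \<Longrightarrow> v \<in> Hor p \<Longrightarrow> g p w v = 0"
  by (simp_all add: hor_dist_def ortho_def g_sym[of p w v])

text \<open>Near any point the vertical distribution is the common kernel of the components of \<open>dF\<close>,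
  a family of smooth one-forms that are independent because \<open>dF\<close> is onto. The fields dual to these
  one-forms, obtained from a Gram system in a coordinate frame, are horizontal, and orthogonal
  projection to their span, again a Gram system, splits off the horizontal part.\<close>

lemma local_splitting:
  "\<exists>U. open U \<and> p \<in> U \<and> (\<forall>v. \<exists>X. smooth_vf_on A U X \<and> X p = v) \<and>
    (\<forall>X. smooth_vf_on A U X \<longrightarrow>
      (\<exists>Y. smooth_vf_on A U Y \<and> (\<forall>q\<in>U. Y q \<in> Hor q \<and> X q - Y q \<in> Ver q)))"
proof -
  let ?c = "chart_at A p" and ?d = "chart_at B (F p)"
  define U where "U = fst ?c \<inter> F -` fst ?d"
  have c: "?c \<in> A" and d: "?d \<in> B" by (rule chart_at_in[OF A] chart_at_in[OF B])+
  have U: "open U"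
    unfolding U_def using F manifold_open_dom[OF A c] manifold_open_dom[OF B d]
    by (auto simp: smooth_map_def continuous_on_open_vimage)
  have pU: "p \<in> U" by (simp add: U_def chart_at_dom[OF A] chart_at_dom[OF B])
  have Uc: "U \<subseteq> fst ?c" and Ud: "\<And>q. q \<in> U \<Longrightarrow> F q \<in> fst ?d" by (auto simp: U_def)
  obtain n and b :: "nat \<Rightarrow> 'e" where b: "orthonormal_basis n b"
    using orthonormal_basis_exists by blast
  obtain m and b' :: "nat \<Rightarrow> 'f" where b': "orthonormal_basis m b'"
    using orthonormal_basis_exists by blast
  define E where "E i = coordinate_field A ?c (b i)" for i
  \<comment> \<open>the components of \<open>dF\<close> as one-forms; below, \<open>Z i\<close> is dual to \<open>\<alpha> i\<close>\<close>
  define \<alpha> where "\<alpha> i q v = inner (components B ?d (F q) (dF q v)) (b' i)" for i q v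
  have E: "smooth_vf_on A U (E i)" for i
    unfolding E_def by (rule smooth_coordinate_field[OF A c U Uc])
  have E_indep: "E i q \<notin> span ((\<lambda>j. E j q) ` {..<i})" if "i < n" "q \<in> U" for i q
    unfolding E_def using coordinate_frame_independent[OF A c _ b that(1)] that(2) Uc by blast
  have E_span: "v \<in> span ((\<lambda>j. E j q) ` {..<n})" if "q \<in> U" for q v
    unfolding E_def using coordinate_frame_spans[OF A c _ b] that Uc by blast
  have lin_\<alpha>: "linear (\<alpha> i q)" if "q \<in> U" for i q
    using lin_dF[of q] linear_components[OF B d Ud[OF that]]
    by (auto simp: \<alpha>_def[abs_def] linear_iff inner_add_left)
  have \<alpha>E: "smooth_fun_on A U (\<lambda>q. \<alpha> i q (E j q))" for i j
  proof (rule smooth_fun_on_chartI[OF A c U Uc])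
    let ?f = "snd ?d \<circ> F \<circ> chart_inv ?c"
    have o: "open (snd ?c ` U)" using manifold_open_image[OF A c U] Uc by (simp add: Int_absorb1)
    have f: "smooth_on (snd ?c ` U) ?f" using F c d by (simp add: smooth_map_def U_def)
    show "smooth_on (snd ?c ` U) ((\<lambda>q. \<alpha> i q (E j q)) \<circ> chart_inv ?c)"
    proof (rule smooth_on_cong[OF o smooth_on_inner_left[OF o smooth_on_frechet_derivative[OF f]]])
      fix x assume "x \<in> snd ?c ` U"
      then obtain q where q: "q \<in> U" "q \<in> fst ?c" "x = snd ?c q" using Uc by auto
      show "inner (frechet_derivative ?f (at x) (b j)) (b' i) = ((\<lambda>q. \<alpha> i q (E j q)) \<circ> chart_inv ?c) x"
        using components_differential[OF A B F c q(2) d Ud[OF q(1)], of "E j q"]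
          components_coordinate_field[OF A c q(2), of "b j"]
        by (simp add: q(3) manifold_chart_inv[OF A c q(2)] \<alpha>_def E_def)
    qed
  qed
  have "\<exists>Z. smooth_vf_on A U Z \<and> (\<forall>q\<in>U. \<forall>j<n. g q (Z q) (E j q) = \<alpha> i q (E j q))" for i
    using smooth_gram_system_solvable[OF A g U, of n E "\<lambda>j q. \<alpha> i q (E j q)"] E E_indep \<alpha>E by blast
  then obtain Z where Z: "\<And>i. smooth_vf_on A U (Z i)"
    "\<And>i q j. q \<in> U \<Longrightarrow> j < n \<Longrightarrow> g q (Z i q) (E j q) = \<alpha> i q (E j q)"
    by metis
  have Z_dual: "g q (Z i q) v = \<alpha> i q v" if "q \<in> U" for i q v
    by (rule linear_eq_on_span[OF metric_linear_right[OF g] lin_\<alpha>[OF that] _ E_span[OF that]])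
       (use Z(2)[OF that] in auto)
  have Z_indep: "Z i q \<notin> span ((\<lambda>j. Z j q) ` {..<i})" if i: "i < m" and q: "q \<in> U" for i q
  proof
    assume *: "Z i q \<in> span ((\<lambda>j. Z j q) ` {..<i})"
    obtain v where v: "dF q v = coordinate_field B ?d (b' i) (F q)" using surj_dF by (metis surjD)
    have val: "\<alpha> j q v = inner (b' i) (b' j)" for j
      by (simp add: \<alpha>_def v components_coordinate_field[OF B d Ud[OF q]])
    have "g q v (Z i q) = 0"
      by (rule metric_zero_on_span[OF g _ *])
         (use orthonormal_basis_inner[OF b'] i in \<open>auto simp: g_sym[of q v] Z_dual[OF q] val\<close>)
    then show False
      using orthonormal_basis_inner[OF b' i i] by (simp add: g_sym[of q v] Z_dual[OF q] val)
  qed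
  have Ver_iff: "v \<in> Ver q" if q: "q \<in> U" and "\<And>i. i < m \<Longrightarrow> \<alpha> i q v = 0" for q v
  proof -
    let ?L = "components B ?d (F q)"
    have "(\<Sum>i<m. inner (?L (dF q v)) (b' i) *\<^sub>R b' i) = ?L (dF q v)"
      using b' by (simp add: orthonormal_basis_def)
    then have "?L (dF q v) = 0" using that(2) by (simp add: \<alpha>_def)
    also have "0 = ?L 0" using linear_0[OF linear_components[OF B d Ud[OF q]]] by simp
    finally have "dF q v = 0" by (metis coordinate_field_components[OF B d Ud[OF q]])
    then show ?thesis by (simp add: ker_dist_def)
  qed
  have "\<exists>Y. smooth_vf_on A U Y \<and> (\<forall>q\<in>U. Y q \<in> Hor q \<and> X q - Y q \<in> Ver q)"
    if X: "smooth_vf_on A U X" for X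
  proof -
    obtain Y where Y: "smooth_vf_on A U Y" "\<And>q. q \<in> U \<Longrightarrow> Y q \<in> span ((\<lambda>j. Z j q) ` {..<m})"
      "\<And>q i. q \<in> U \<Longrightarrow> i < m \<Longrightarrow> g q (Y q) (Z i q) = g q (X q) (Z i q)"
      using smooth_gram_system_solvable[OF A g U, of m Z "\<lambda>i q. g q (X q) (Z i q)"]
        Z(1) Z_indep metric_smooth[OF g U X Z(1)] by blast
    have "Y q \<in> Hor q" if q: "q \<in> U" for q
      unfolding hor_dist_def ortho_def
    proof clarify
      fix w assume "w \<in> Ver q"
      then have "\<alpha> i q w = 0" for i
        using linear_0[OF linear_components[OF B d Ud[OF q]]] by (simp add: \<alpha>_def ker_dist_def)
      then have "g q w (Y q) = 0"
        by (intro metric_zero_on_span[OF g _ Y(2)[OF q]]) (auto simp: g_sym[of q w] Z_dual[OF q])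
      then show "g q (Y q) w = 0" by (simp add: g_sym)
    qed
    moreover have "X q - Y q \<in> Ver q" if q: "q \<in> U" for q
    proof (rule Ver_iff[OF q])
      fix i assume "i < m"
      then have "g q (X q - Y q) (Z i q) = 0" using Y(3)[OF q] by (simp add: g_simps)
      then show "\<alpha> i q (X q - Y q) = 0" using Z_dual[OF q] by (simp add: g_sym)
    qed
    ultimately show ?thesis using Y(1) by blast
  qed
  moreover have "\<exists>X. smooth_vf_on A U X \<and> X p = v" for v
    using smooth_coordinate_field[OF A c U Uc] coordinate_field_components[OF A c chart_at_dom[OF A]]
    by blast
  ultimately show ?thesis using U pU by blast
qed

lemma pointwise_splitting:
  obtains a b where "a \<in> Hor p" "b \<in> Ver p" "v = a + b"
proof -
  obtain U X where U: "p \<in> U" "smooth_vf_on A U X" "X p = v"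
    and "\<exists>Y. smooth_vf_on A U Y \<and> (\<forall>q\<in>U. Y q \<in> Hor q \<and> X q - Y q \<in> Ver q)"
    using local_splitting[of p] by metis
  then obtain Y where "Y p \<in> Hor p" "v - Y p \<in> Ver p" by blast
  then show thesis using that[of "Y p" "v - Y p"] by simp
qed

lemma hpart_eq: "a \<in> Hor p \<Longrightarrow> b \<in> Ver p \<Longrightarrow> X p = a + b \<Longrightarrow> hpart X p = a"
  unfolding hor_def by (rule part_in_orthogonal[OF g subspace_Hor subspace_Ver Hor_Ver])

lemma vpart_eq: "a \<in> Ver p \<Longrightarrow> b \<in> Hor p \<Longrightarrow> X p = a + b \<Longrightarrow> vpart X p = a"
  unfolding ver_def by (rule part_in_orthogonal[OF g subspace_Ver subspace_Hor Ver_Hor])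

lemma hpart_in: "hpart X p \<in> Hor p"
  and vpart_in: "vpart X p \<in> Ver p"
  and hpart_vpart: "hpart X p + vpart X p = X p"
proof -
  obtain a b where ab: "a \<in> Hor p" "b \<in> Ver p" "X p = a + b" by (rule pointwise_splitting)
  then have "hpart X p = a" "vpart X p = b"
    using hpart_eq[of a p b X] vpart_eq[of b p a X] by (simp_all add: add.commute)
  then show "hpart X p \<in> Hor p" "vpart X p \<in> Ver p" "hpart X p + vpart X p = X p"
    using ab by simp_all
qed

lemma hpart_smooth:
  assumes "X \<in> vector_fields A"
  shows "hpart X \<in> sections A Hor"
proof -
  have X: "smooth_vf_on A UNIV X" using assms by (simp add: sections_def)
  have "smooth_vf_on A UNIV (hpart X)"
  proof (rule smooth_vf_on_local[OF A])
    fix p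
    obtain U where U: "open U" "p \<in> U"
      "\<And>X. smooth_vf_on A U X \<Longrightarrow> \<exists>Y. smooth_vf_on A U Y \<and> (\<forall>q\<in>U. Y q \<in> Hor q \<and> X q - Y q \<in> Ver q)"
      using local_splitting[of p] by blast
    then obtain Y where Y: "smooth_vf_on A U Y" "\<And>q. q \<in> U \<Longrightarrow> Y q \<in> Hor q \<and> X q - Y q \<in> Ver q"
      using smooth_vf_on_subset[OF X] by (metis subset_UNIV)
    have "smooth_vf_on A U (hpart X)"
      by (rule smooth_vf_on_cong[OF A U(1) Y(1)])
         (use Y(2) hpart_eq in \<open>metis add.commute diff_add_cancel\<close>)
    then show "\<exists>U. open U \<and> p \<in> U \<and> smooth_vf_on A U (hpart X)" using U by blast
  qed
  then show ?thesis by (simp add: sections_def hpart_in)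
qed

lemma vpart_smooth:
  assumes "X \<in> vector_fields A"
  shows "vpart X \<in> sections A Ver"
proof -
  have "vpart X = (\<lambda>p. X p - hpart X p)"
    by (rule ext) (metis hpart_vpart add_diff_cancel_left')
  moreover have "smooth_vf_on A UNIV (\<lambda>p. X p - hpart X p)"
    using assms hpart_smooth[OF assms]
    by (intro smooth_vf_on_diff[OF A open_UNIV]) (simp_all add: sections_def)
  ultimately have "smooth_vf_on A UNIV (vpart X)" by simp
  then show ?thesis by (simp add: sections_def vpart_in)
qed

end

section \<open>Semi-invariance under one parallel complex structure\<close>

text \<open>Each of the conditions \<open>(P\<^sub>I)\<close>, \<open>(P\<^sub>J)\<close>, \<open>(P\<^sub>K)\<close> involves one complex structure only, and so does
  the argument. So one parallel isometry \<open>R\<close> with \<open>R\<^sup>2 = - id\<close> is fixed here, to be specialised to each of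
  the three.\<close>

locale semi_invariant_submersion = submersion_from_riemannian A B g F
  for A :: "('m::{t2_space, second_countable_topology}, 'e::finite_dim_inner) atlas"
    and B :: "('n::{t2_space, second_countable_topology}, 'f::finite_dim_inner) atlas"
    and g :: "'m \<Rightarrow> 'e \<Rightarrow> 'e \<Rightarrow> real"
    and F :: "'m \<Rightarrow> 'n" +
  fixes R :: "'m \<Rightarrow> 'e \<Rightarrow> 'e"
    and h :: "'n \<Rightarrow> 'f \<Rightarrow> 'f \<Rightarrow> real"
    and nab :: "('m \<Rightarrow> 'e) \<Rightarrow> ('m \<Rightarrow> 'e) \<Rightarrow> 'm \<Rightarrow> 'e"
    and nabF :: "('m \<Rightarrow> 'e) \<Rightarrow> ('m \<Rightarrow> 'f) \<Rightarrow> 'm \<Rightarrow> 'f"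
    and dil :: "'m \<Rightarrow> real"
    and D1 :: "'m \<Rightarrow> 'e set"
  assumes h: "riemannian_metric B h"
    and nab: "levi_civita A g nab"
    and nabF: "connection A (sections_along A B F (\<lambda>_. UNIV)) nabF"
    and R_square: "R p (R p v) = - v"
    and R_field: "endomorphism_field A R"
    and R_isometry: "g p (R p v) (R p w) = g p v w"
    and R_parallel: "X \<in> vector_fields A \<Longrightarrow> Y \<in> vector_fields A \<Longrightarrow>
      nab X (\<lambda>q. R q (Y q)) p = R p (nab X Y p)"
    and dil_pos: "dil p > 0"
    and conformal: "v \<in> hor_dist A g B F p \<Longrightarrow> w \<in> hor_dist A g B F p \<Longrightarrow>
      h (F p) (differential A B F p v) (differential A B F p w) = (dil p)\<^sup>2 * g p v w"
    and subspace_D1: "subspace (D1 p)"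
    and D1_Ver: "D1 p \<subseteq> ker_dist A B F p"
    and Ver_sum: "ker_dist A B F p = {u + v |u v. u \<in> D1 p \<and> v \<in> D2_dist A g B F D1 p}"
    and R_D1: "R p ` D1 p = D1 p"
    and R_D2: "R p ` D2_dist A g B F D1 p \<subseteq> hor_dist A g B F p"
begin

abbreviation "D2 \<equiv> D2_dist A g B F D1"
abbreviation "Mu \<equiv> mu_dist A g B F D1 R"

lemma linear_R: "linear (R p)"
  using R_field by (simp add: endomorphism_field_def)

lemma R_smooth: "X \<in> vector_fields A \<Longrightarrow> (\<lambda>p. R p (X p)) \<in> vector_fields A"
  using R_field unfolding endomorphism_field_def sections_def by auto

lemma R_skew: "g p (R p v) w = - g p v (R p w)"
  using R_isometry[of p v "R p w"] by (simp add: R_square g_simps)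

lemma D1_D2_orthogonal: "u \<in> D1 p \<Longrightarrow> v \<in> D2 p \<Longrightarrow> g p v u = 0"
  by (auto simp: D2_dist_def ortho_def)

lemma D2_Ver: "v \<in> D2 p \<Longrightarrow> v \<in> Ver p"
  by (simp add: D2_dist_def)

lemma subspace_D2: "subspace (D2 p)"
  unfolding D2_dist_def by (intro subspace_inter subspace_Ver subspace_ortho)

lemma subspace_Mu: "subspace (Mu p)"
  unfolding mu_dist_def by (intro subspace_inter subspace_Hor subspace_ortho)

lemma Mu_Hor: "v \<in> Mu p \<Longrightarrow> v \<in> Hor p"
  by (simp add: mu_dist_def)

lemma Mu_iff: "v \<in> Mu p \<longleftrightarrow> v \<in> Hor p \<and> (\<forall>w\<in>D2 p. g p v (R p w) = 0)"
  by (auto simp: mu_dist_def ortho_def)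

lemma R_D1_in: "v \<in> D1 p \<Longrightarrow> R p v \<in> D1 p"
  using R_D1[of p] by blast

lemma R_D2_in: "v \<in> D2 p \<Longrightarrow> R p v \<in> Hor p"
  using R_D2[of p] by blast

lemma sections_D1_smooth: "X \<in> sections A D1 \<Longrightarrow> X \<in> vector_fields A"
  by (simp add: sections_def)

lemma sections_Hor_smooth: "X \<in> sections A Hor \<Longrightarrow> X \<in> vector_fields A"
  by (simp add: sections_def)

text \<open>For horizontal \<open>Z\<close> the splitting \<open>RZ = BZ + CZ\<close> is just the splitting of \<open>RZ\<close> into its vertical and
  horizontal parts: since \<open>R\<close> is skew and preserves \<open>\<D>\<^sub>1\<close>, the vertical part is orthogonal to \<open>\<D>\<^sub>1\<close>,
  and since \<open>R\<close> is an isometry, the horizontal part is orthogonal to \<open>R\<D>\<^sub>2\<close>.\<close>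

lemma vpart_R_D2: "Z p \<in> Hor p \<Longrightarrow> vpart (\<lambda>q. R q (Z q)) p \<in> D2 p"
  and hpart_R_Mu: "Z p \<in> Hor p \<Longrightarrow> hpart (\<lambda>q. R q (Z q)) p \<in> Mu p"
proof -
  assume Z: "Z p \<in> Hor p"
  let ?v = "vpart (\<lambda>q. R q (Z q)) p" and ?w = "hpart (\<lambda>q. R q (Z q)) p"
  have sum: "R p (Z p) = ?w + ?v" by (rule hpart_vpart[symmetric])
  note vw = vpart_in[of "\<lambda>q. R q (Z q)" p] hpart_in[of "\<lambda>q. R q (Z q)" p]
  have "g p ?v u = 0" if u: "u \<in> D1 p" for u
  proof -
    have "g p ?w u = 0" using Hor_Ver[OF vw(2)] u D1_Ver by blast
    then have "g p ?v u = g p (R p (Z p)) u" by (simp add: sum g_simps)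
    also have "\<dots> = - g p (Z p) (R p u)" by (rule R_skew)
    also have "g p (Z p) (R p u) = 0" using Hor_Ver[OF Z] R_D1_in[OF u] D1_Ver by blast
    finally show ?thesis by simp
  qed
  then show "?v \<in> D2 p" using vw by (simp add: D2_dist_def ortho_def)
  have "g p ?w (R p u) = 0" if u: "u \<in> D2 p" for u
  proof -
    have "g p ?v (R p u) = 0" using Ver_Hor[OF vw(1) R_D2_in[OF u]] .
    then have "g p ?w (R p u) = g p (R p (Z p)) (R p u)" by (simp add: sum g_simps)
    also have "\<dots> = 0" using R_isometry Hor_Ver[OF Z D2_Ver[OF u]] by simp
    finally show ?thesis .
  qed
  then show "?w \<in> Mu p" using vw by (simp add: Mu_iff)
qed

lemma B_op_eq: "Z p \<in> Hor p \<Longrightarrow> B_op A g B F D1 R Z p = vpart (\<lambda>q. R q (Z q)) p"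
  unfolding B_op_def
  by (rule part_in_orthogonal[where p = p, OF g subspace_D2 subspace_Mu _ vpart_R_D2 hpart_R_Mu])
     (auto simp: Ver_Hor D2_Ver Mu_Hor hpart_vpart add.commute[of "vpart _ _"])

lemma C_op_eq: "Z p \<in> Hor p \<Longrightarrow> C_op A g B F D1 R Z p = hpart (\<lambda>q. R q (Z q)) p"
  unfolding C_op_def
  by (rule part_in_orthogonal[where p = p, OF g subspace_Mu subspace_D2 _ hpart_R_Mu vpart_R_D2])
     (auto simp: Hor_Ver D2_Ver Mu_Hor hpart_vpart)

lemma omega_op_eq: "Y p \<in> D2 p \<Longrightarrow> omega_op A g B F D1 R Y p = R p (Y p)"
  unfolding omega_op_def
  by (rule part_in_orthogonal[where p = p and b = 0,
        OF g linear_subspace_image[OF linear_R subspace_D2] subspace_D1])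
     (use subspace_0[OF subspace_D1] in \<open>auto intro!: Hor_Ver R_D2_in subsetD[OF D1_Ver]\<close>)

lemma omega_B_eq:
  assumes "X \<in> sections A Hor"
  shows "omega_op A g B F D1 R (B_op A g B F D1 R X) = (\<lambda>q. R q (vpart (\<lambda>p. R p (X p)) q))"
proof
  fix p
  have X: "X p \<in> Hor p" using assms by (simp add: sections_def)
  have "B_op A g B F D1 R X p \<in> D2 p" using vpart_R_D2[of X p] X by (simp add: B_op_eq)
  then show "omega_op A g B F D1 R (B_op A g B F D1 R X) p = R p (vpart (\<lambda>p. R p (X p)) p)"
    using X by (simp add: omega_op_eq B_op_eq)
qed

text \<open>A connection is determined on smooth fields only, so \<open>\<nabla>\<^sub>V(\<omega>BX)\<close> can be computed with only once
  \<open>\<omega>BX = R\<V>(RX)\<close> is known to be smooth. This is what smoothness of the vertical part is for.\<close>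

lemma R_vpart_R_horizontal:
  assumes "X \<in> sections A Hor"
  shows "(\<lambda>q. R q (vpart (\<lambda>p. R p (X p)) q)) \<in> sections A Hor"
proof -
  have "(\<lambda>p. R p (X p)) \<in> vector_fields A" by (rule R_smooth[OF sections_Hor_smooth[OF assms]])
  then have "(\<lambda>q. R q (vpart (\<lambda>p. R p (X p)) q)) \<in> vector_fields A"
    using vpart_smooth by (intro R_smooth) (simp add: sections_def)
  moreover have "R p (vpart (\<lambda>p. R p (X p)) p) \<in> Hor p" for p
    using assms by (intro R_D2_in vpart_R_D2) (simp add: sections_def)
  ultimately show ?thesis by (simp add: sections_def)
qed

lemma connection_zero:
  assumes "connection A S con" "X \<in> vector_fields A" "(\<lambda>_. 0) \<in> S"
  shows "con X (\<lambda>_. 0) p = 0"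
proof -
  have "con X (\<lambda>q. 0 + 0) p = con X (\<lambda>_. 0) p + con X (\<lambda>_. 0) p"
    using assms unfolding connection_def by fast
  then show ?thesis by simp
qed

lemma nab_smooth: "X \<in> vector_fields A \<Longrightarrow> Y \<in> vector_fields A \<Longrightarrow> nab X Y \<in> vector_fields A"
  using nab by (auto simp: levi_civita_def connection_def)

lemma T_tensor_eq:
  assumes "V \<in> sections A D1" "Z \<in> sections A Hor"
  shows "T_tensor A g B F nab V Z p = vpart (nab V Z) p"
proof -
  have V: "V q \<in> Ver q" and Z: "Z q \<in> Hor q" for q using assms D1_Ver by (auto simp: sections_def)
  have 1: "vpart V = V" "vpart Z = (\<lambda>_. 0)" "hpart Z = Z" "\<And>q. hpart (\<lambda>_. 0) q = 0"
    using vpart_eq[OF V subspace_0[OF subspace_Hor]] vpart_eq[OF subspace_0[OF subspace_Ver] Z]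
      hpart_eq[OF Z subspace_0[OF subspace_Ver]]
      hpart_eq[OF subspace_0[OF subspace_Hor] subspace_0[OF subspace_Ver]]
    by (auto intro!: ext)
  have "(\<lambda>_. 0) \<in> vector_fields A" by (simp add: sections_def smooth_vf_on_zero[OF A])
  then have "nab V (\<lambda>_. 0) = (\<lambda>_. 0)"
    using connection_zero[of "vector_fields A" nab V] nab sections_D1_smooth[OF assms(1)]
    by (auto simp: levi_civita_def)
  then show ?thesis by (simp add: T_tensor_def 1)
qed

text \<open>The derivative of the constant \<open>g(W, Z) = 0\<close>, expanded by metric compatibility.\<close>

lemma nab_orthogonal:
  assumes "V \<in> vector_fields A" "W \<in> vector_fields A" "Z \<in> vector_fields A" "\<And>q. g q (W q) (Z q) = 0"
  shows "g p (W p) (nab V Z p) = - g p (nab V W p) (Z p)"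
proof -
  have "dir_deriv A V (\<lambda>q. g q (W q) (Z q)) p = g p (nab V W p) (Z p) + g p (W p) (nab V Z p)"
    using nab assms(1-3) unfolding levi_civita_def by fast
  moreover have "dir_deriv A V (\<lambda>q. g q (W q) (Z q)) p = 0"
    by (simp add: assms(4) dir_deriv_def o_def frechet_derivative_const)
  ultimately show ?thesis by simp
qed

text \<open>As \<open>RW\<close> is vertical, \<open>F\<^sub>*(RW)\<close> is the zero section and only the term \<open>F\<^sub>*(\<nabla>\<^sub>V RW)\<close> of the second
  fundamental form survives; \<open>R\<close> commutes with \<open>\<nabla>\<close>.\<close>

lemma second_fundamental_form_eq:
  assumes V: "V \<in> sections A D1" and W: "W \<in> sections A D1"
  shows "second_fundamental_form A B F nab nabF V (\<lambda>q. R q (W q)) p = - dF p (R p (nab V W p))"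
proof -
  have "dF q (R q (W q)) = 0" for q
    using R_D1_in[of "W q" q] D1_Ver[of q] W by (auto simp: ker_dist_def sections_def)
  moreover have "nabF V (\<lambda>_. 0) p = 0"
    by (rule connection_zero[OF nabF sections_D1_smooth[OF V] zero_section_along[OF A B F]]) simp
  ultimately show ?thesis
    using R_parallel[OF sections_D1_smooth[OF V] sections_D1_smooth[OF W]]
    by (simp add: second_fundamental_form_def)
qed

lemma dF_hpart: "dF p (X p) = dF p (hpart X p)"
proof -
  have "dF p (hpart X p + vpart X p) = dF p (hpart X p)"
    using vpart_in[of X p] by (simp add: linear_add[OF lin_dF] ker_dist_def)
  then show ?thesis by (simp add: hpart_vpart)
qed

lemma inj_dF_Hor:
  assumes "v \<in> Hor p" "w \<in> Hor p" "dF p v = dF p w"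
  shows "v = w"
proof -
  have "v - w \<in> Hor p" "v - w \<in> Ver p"
    using assms subspace_diff[OF subspace_Hor] by (auto simp: ker_dist_def linear_diff[OF lin_dF])
  then have "g p (v - w) (v - w) = 0" by (rule Hor_Ver)
  then show ?thesis using metric_pos[OF g, of "v - w" p] by force
qed

text \<open>\<open>F\<^sub>*\<close> is injective on horizontal vectors, so \<open>F\<^sub>*(RN)\<close> lies in \<open>F\<^sub>*\<mu>\<close> exactly if the horizontal part
  of \<open>RN\<close> is orthogonal to \<open>R\<D>\<^sub>2\<close>. Its vertical part is so anyway, and \<open>R\<close> is an isometry.\<close>

lemma image_Mu_iff: "- dF p (R p N) \<in> dF p ` Mu p \<longleftrightarrow> (\<forall>w\<in>D2 p. g p N w = 0)"
proof -
  let ?H = "hpart (\<lambda>q. R q N) p" and ?V = "vpart (\<lambda>q. R q N) p"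
  have H: "?H \<in> Hor p" and sum: "R p N = ?H + ?V"
    using hpart_in hpart_vpart[of "\<lambda>q. R q N" p] by simp_all
  have "- dF p (R p N) = dF p (- ?H)"
    using dF_hpart[of p "\<lambda>q. R q N"] by (simp add: linear_neg[OF lin_dF])
  moreover have "- ?H \<in> Hor p" by (rule subspace_neg[OF subspace_Hor H])
  ultimately have "- dF p (R p N) \<in> dF p ` Mu p \<longleftrightarrow> - ?H \<in> Mu p"
    using inj_dF_Hor[of "- ?H" p] Mu_Hor by auto
  also have "\<dots> \<longleftrightarrow> (\<forall>w\<in>D2 p. g p ?H (R p w) = 0)"
    using \<open>- ?H \<in> Hor p\<close> by (simp add: Mu_iff g_simps)
  also have "\<dots> \<longleftrightarrow> (\<forall>w\<in>D2 p. g p N w = 0)"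
  proof (rule ball_cong[OF refl])
    fix w assume "w \<in> D2 p"
    then have "g p ?V (R p w) = 0" by (intro Ver_Hor[OF vpart_in R_D2_in])
    then have "g p ?H (R p w) = g p (R p N) (R p w)" by (simp add: sum g_simps)
    then show "g p ?H (R p w) = 0 \<longleftrightarrow> g p N w = 0" by (simp add: R_isometry)
  qed
  finally show ?thesis .
qed

text \<open>With \<open>N = \<nabla>\<^sub>V W\<close>, conformality turns the left-hand side into \<open>- \<lambda>\<^sup>2 g(RN, CX)\<close>, and differentiating
  \<open>g(W, \<omega>BX) = 0\<close> turns the right-hand side into \<open>\<lambda>\<^sup>2 g(RN, BX)\<close>. As \<open>BX + CX = RX\<close>, equality
  says that \<open>RN\<close> is orthogonal to \<open>RX\<close>.\<close>

lemma metric_equation_iff: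
  assumes V: "V \<in> sections A D1" and W: "W \<in> sections A D1" and X: "X \<in> sections A Hor"
  shows "h (F p) (second_fundamental_form A B F nab nabF V (\<lambda>q. R q (W q)) p)
        (dF p (C_op A g B F D1 R X p)) =
      (dil p)\<^sup>2 * g p (W p) (T_tensor A g B F nab V (omega_op A g B F D1 R (B_op A g B F D1 R X)) p)
    \<longleftrightarrow> g p (nab V W p) (X p) = 0"
proof -
  let ?RX = "\<lambda>q. R q (X q)" and ?N = "nab V W p"
  let ?Z = "\<lambda>q. R q (vpart ?RX q)"
  note V' = sections_D1_smooth[OF V] and W' = sections_D1_smooth[OF W]
  have Xp: "X p \<in> Hor p" using X by (simp add: sections_def)
  have Z: "?Z \<in> sections A Hor" by (rule R_vpart_R_horizontal[OF X])
  have WZ: "g q (W q) (?Z q) = 0" for q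
    using W Z D1_Ver by (intro Ver_Hor) (auto simp: sections_def)
  let ?H = "hpart (\<lambda>q. R q ?N) p"
  have C: "C_op A g B F D1 R X p = hpart ?RX p" by (rule C_op_eq[of X, OF Xp])
  have "h (F p) (- dF p (R p ?N)) (dF p (hpart ?RX p)) = h (F p) (dF p (- ?H)) (dF p (hpart ?RX p))"
    using dF_hpart[of p "\<lambda>q. R q ?N"] by (simp add: linear_neg[OF lin_dF])
  also have "\<dots> = (dil p)\<^sup>2 * g p (- ?H) (hpart ?RX p)"
    by (rule conformal[OF subspace_neg[OF subspace_Hor hpart_in] hpart_in])
  also have "g p (- ?H) (hpart ?RX p) = - g p (R p ?N) (hpart ?RX p)"
    using hpart_vpart[of "\<lambda>q. R q ?N" p, symmetric] Ver_Hor[OF vpart_in hpart_in]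
    by (simp add: g_simps)
  finally have lhs: "h (F p) (- dF p (R p ?N)) (dF p (hpart ?RX p)) =
    (dil p)\<^sup>2 * (- g p (R p ?N) (hpart ?RX p))" .
  have Wp: "W p \<in> Ver p" using W D1_Ver by (auto simp: sections_def)
  have "g p (W p) (vpart (nab V ?Z) p) = g p (W p) (hpart (nab V ?Z) p + vpart (nab V ?Z) p)"
    by (simp add: g_simps(2) Ver_Hor[OF Wp hpart_in])
  also have "\<dots> = g p (W p) (nab V ?Z p)" by (simp only: hpart_vpart)
  also have "\<dots> = - g p ?N (?Z p)"
    by (rule nab_orthogonal[OF V' W' sections_Hor_smooth[OF Z] WZ])
  also have "\<dots> = g p (R p ?N) (vpart ?RX p)" by (simp add: R_skew)
  finally have rhs: "g p (W p) (T_tensor A g B F nab V (omega_op A g B F D1 R (B_op A g B F D1 R X)) p) =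
      g p (R p ?N) (vpart ?RX p)"
    by (simp add: omega_B_eq[OF X] T_tensor_eq[OF V Z])
  have "g p ?N (X p) = g p (R p ?N) (hpart ?RX p + vpart ?RX p)"
    by (simp add: hpart_vpart R_isometry)
  then have "g p ?N (X p) = g p (R p ?N) (hpart ?RX p) + g p (R p ?N) (vpart ?RX p)"
    by (simp add: g_simps)
  moreover have "(dil p)\<^sup>2 \<noteq> 0" using dil_pos[of p] by simp
  ultimately show ?thesis
    unfolding second_fundamental_form_eq[OF V W] C lhs rhs
    by (simp only: mult_cancel_left neg_eq_iff_add_eq_0 simp_thms)
qed

text \<open>If \<open>N = u + v\<close> with \<open>u \<in> \<D>\<^sub>1\<close> and \<open>v \<in> \<D>\<^sub>2\<close> is orthogonal to \<open>\<D>\<^sub>2\<close>, then \<open>g(v, v) = g(N, v) = 0\<close>.\<close>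

lemma D1_iff:
  "N \<in> D1 p \<longleftrightarrow> (\<forall>w\<in>D2 p. g p N w = 0) \<and> N \<in> Ver p"
proof
  assume "N \<in> D1 p"
  then show "(\<forall>w\<in>D2 p. g p N w = 0) \<and> N \<in> Ver p"
    using D1_D2_orthogonal D1_Ver[of p] by (auto simp: g_sym[of p N])
next
  assume N: "(\<forall>w\<in>D2 p. g p N w = 0) \<and> N \<in> Ver p"
  then obtain u v where uv: "u \<in> D1 p" "v \<in> D2 p" "N = u + v" using Ver_sum[of p] by auto
  have "g p u v = 0" using D1_D2_orthogonal[OF uv(1,2)] by (simp add: g_sym)
  then have "g p v v = 0" using N uv by (auto simp: g_simps)
  then have "v = 0" using metric_pos[OF g, of v p] by force
  then show "N \<in> D1 p" using uv by simp
qed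

text \<open>By \<open>image_Mu_iff\<close> and \<open>metric_equation_iff\<close> the condition says that every \<open>\<nabla>\<^sub>V W\<close> is orthogonal to
  \<open>\<D>\<^sub>2\<close> and to all smooth horizontal fields. Conversely, the horizontal part of \<open>\<nabla>\<^sub>V W\<close> is
  itself such a field; tested against it, the equation forces this part to vanish.\<close>

theorem totally_geodesic_iff_condition_P:
  "totally_geodesic_foliation A nab D1 \<longleftrightarrow> condition_P A g nab B h nabF F dil D1 R"
proof
  assume tg: "totally_geodesic_foliation A nab D1"
  show "condition_P A g nab B h nabF F dil D1 R"
    unfolding condition_P_def Let_def
  proof (intro ballI conjI allI)
    fix V W X p
    assume V: "V \<in> sections A D1" and W: "W \<in> sections A D1" and X: "X \<in> sections A Hor"
    have N: "nab V W q \<in> D1 q" for q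
      using tg V W by (auto simp: totally_geodesic_foliation_def sections_def)
    have "dF q (R q (nab V W q)) = 0" for q
      using R_D1_in[OF N] D1_Ver[of q] by (auto simp: ker_dist_def)
    then have "second_fundamental_form A B F nab nabF V (\<lambda>q. R q (W q)) = (\<lambda>_. 0)"
      by (simp add: second_fundamental_form_eq[OF V W] fun_eq_iff)
    moreover have "0 \<in> dF q ` Mu q" for q
      using linear_0[OF lin_dF[of q]] subspace_0[OF subspace_Mu[of q]] by (metis imageI)
    ultimately show "second_fundamental_form A B F nab nabF V (\<lambda>q. R q (W q))
        \<in> sections_along A B F (\<lambda>p. dF p ` Mu p)"
      using zero_section_along[OF A B F] by simp
    have "g p (nab V W p) (X p) = 0"
      using N[of p] D1_Ver X by (intro Ver_Hor) (auto simp: sections_def)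
    then show "h (F p) (second_fundamental_form A B F nab nabF V (\<lambda>q. R q (W q)) p)
        (dF p (C_op A g B F D1 R X p)) =
      (dil p)\<^sup>2 * g p (W p) (T_tensor A g B F nab V (omega_op A g B F D1 R (B_op A g B F D1 R X)) p)"
      by (simp only: metric_equation_iff[OF V W X])
  qed
next
  assume P: "condition_P A g nab B h nabF F dil D1 R"
  show "totally_geodesic_foliation A nab D1"
    unfolding totally_geodesic_foliation_def
  proof (intro ballI)
    fix V W assume V: "V \<in> sections A D1" and W: "W \<in> sections A D1"
    let ?N = "nab V W"
    \<comment> \<open>\<open>hpart ?N\<close> is the field against which the equation in \<open>(P\<^sub>R)\<close> is tested.\<close>
    have N: "?N \<in> vector_fields A"
      by (rule nab_smooth[OF sections_D1_smooth[OF V] sections_D1_smooth[OF W]])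
    have X: "hpart ?N \<in> sections A Hor" by (rule hpart_smooth[OF N])
    have "?N p \<in> D1 p" for p
    proof -
      have "second_fundamental_form A B F nab nabF V (\<lambda>q. R q (W q))
          \<in> sections_along A B F (\<lambda>p. dF p ` Mu p)"
        using P V W X unfolding condition_P_def Let_def by blast
      then have "second_fundamental_form A B F nab nabF V (\<lambda>q. R q (W q)) p \<in> dF p ` Mu p"
        by (simp add: sections_along_def)
      then have "\<forall>w\<in>D2 p. g p (?N p) w = 0"
        unfolding second_fundamental_form_eq[OF V W] image_Mu_iff .
      moreover have "g p (?N p) (hpart ?N p) = 0"
        using P V W X unfolding condition_P_def Let_def metric_equation_iff[OF V W X, symmetric]
        by blast
      then have "g p (hpart ?N p + vpart ?N p) (hpart ?N p) = 0" by (simp only: hpart_vpart)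
      then have "g p (hpart ?N p) (hpart ?N p) = 0"
        by (simp add: g_simps(1) Ver_Hor[OF vpart_in hpart_in])
      then have "hpart ?N p = 0" using metric_pos[OF g, of "hpart ?N p" p] by force
      then have "?N p \<in> Ver p" using hpart_vpart[of ?N p] vpart_in[of ?N p] by simp
      ultimately show ?thesis by (simp add: D1_iff)
    qed
    then show "nab V W \<in> sections A D1" using N by (simp add: sections_def)
  qed
qed

end

section \<open>The hyperkaehler case\<close>

lemma subspace_distribution: "distribution A D \<Longrightarrow> subspace (D p)"
  unfolding distribution_def by (metis subspace_span)

theorem theorem3p20:
  fixes A :: "('m::{t2_space, second_countable_topology}, 'e::finite_dim_inner) atlas"
    and B :: "('n::{t2_space, second_countable_topology}, 'f::finite_dim_inner) atlas"
    and I J K :: "'m \<Rightarrow> 'e \<Rightarrow> 'e"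
    and gM :: "'m \<Rightarrow> 'e \<Rightarrow> 'e \<Rightarrow> real"
    and gN :: "'n \<Rightarrow> 'f \<Rightarrow> 'f \<Rightarrow> real"
    and nabM :: "('m \<Rightarrow> 'e) \<Rightarrow> ('m \<Rightarrow> 'e) \<Rightarrow> 'm \<Rightarrow> 'e"
    and nabN :: "('n \<Rightarrow> 'f) \<Rightarrow> ('n \<Rightarrow> 'f) \<Rightarrow> 'n \<Rightarrow> 'f"
    and nabF :: "('m \<Rightarrow> 'e) \<Rightarrow> ('m \<Rightarrow> 'f) \<Rightarrow> 'm \<Rightarrow> 'f"
    and F :: "'m \<Rightarrow> 'n"
    and dil :: "'m \<Rightarrow> real"
    and D1 :: "'m \<Rightarrow> 'e set"
  assumes "hyperkaehler A I J K gM nabM"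
    and "smooth_manifold B" and "riemannian_metric B gN" and "levi_civita B gN nabN"
    and "pullback_connection A B F nabN nabF"
    and "h_conformal_semi_invariant_submersion A I J K gM B gN F dil D1"
  shows "(totally_geodesic_foliation A nabM D1 \<longleftrightarrow>
            condition_P A gM nabM B gN nabF F dil D1 I) \<and>
         (totally_geodesic_foliation A nabM D1 \<longleftrightarrow>
            condition_P A gM nabM B gN nabF F dil D1 J) \<and>
         (totally_geodesic_foliation A nabM D1 \<longleftrightarrow>
            condition_P A gM nabM B gN nabF F dil D1 K)"
proof -
  note hk = assms(1)[unfolded hyperkaehler_def]
  note sub = assms(6)[unfolded h_conformal_semi_invariant_submersion_def]
  note conf = sub[THEN conjunct1, unfolded horizontally_conformal_submersion_def]
  have M: "smooth_manifold A" "riemannian_metric A gM" "levi_civita A gM nabM"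
    using hk by blast+
  have square: "I p (I p v) = - v" "J p (J p v) = - v" "K p (K p v) = - v" for p v
    using hk by blast+
  have struct: "endomorphism_field A R" "gM p (R p v) (R p w) = gM p v w"
    "X \<in> vector_fields A \<Longrightarrow> Y \<in> vector_fields A \<Longrightarrow> nabM X (\<lambda>q. R q (Y q)) p = R p (nabM X Y p)"
    if "R \<in> {I, J, K}" for R p v w X Y
    using hk that by blast+
  have F: "smooth_map A B F" "surj (differential A B F p)" "dil p > 0"
    "v \<in> hor_dist A gM B F p \<Longrightarrow> w \<in> hor_dist A gM B F p \<Longrightarrow>
      gN (F p) (differential A B F p v) (differential A B F p w) = (dil p)\<^sup>2 * gM p v w" for p v w
    using conf by simp_all
  note split = sub[THEN conjunct2]
  note D1 = split[THEN conjunct1] split[THEN conjunct2, THEN conjunct1, THEN spec]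
    split[THEN conjunct2, THEN conjunct2, THEN conjunct1, THEN spec, THEN conjunct1]
  note invariant =
    split[THEN conjunct2, THEN conjunct2, THEN conjunct2, THEN bspec, THEN spec, THEN conjunct1]
    split[THEN conjunct2, THEN conjunct2, THEN conjunct2, THEN bspec, THEN spec, THEN conjunct2]
  have con: "connection A (sections_along A B F (\<lambda>_. UNIV)) nabF"
    using assms(5) by (simp add: pullback_connection_def)
  have "semi_invariant_submersion A B gM F R gN nabM nabF dil D1" if R: "R \<in> {I, J, K}" for R
  proof -
    have sq: "R p (R p v) = - v" for p v using R square by (elim insertE emptyE) simp_all
    show ?thesis
      by (intro semi_invariant_submersion.intro submersion_from_riemannian.intro
            semi_invariant_submersion_axioms.intro)
         (fact M assms(2,3) F con sq struct[OF R] subspace_distribution[OF D1(1)] D1 invariant[OF R])+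
  qed
  from this[THEN semi_invariant_submersion.totally_geodesic_iff_condition_P]
  show ?thesis by simp
qed

end
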